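(* Let $\sigma_B^2=a\,\sigma_A^2$ for a fixed constant $a\in(0,\infty)$. Then, as $\sigma_A^2\to0$, $$I(\hat R_A;\hat R_B)-\Big[\tfrac12\log_2\!\Big(\frac{p}{\sigma_A^2+\sigma_B^2}\Big)-\chi\Big]\longrightarrow 0,\qquad \chi=\tfrac12\log_2\!\Big(\frac{4\pi}{e^{1+\gamma}}\Big)\approx 0.69,$$ where $\gamma$ is the Euler–Mascheroni constant.
   Context: Fix $p>0$. Let $H$ be a zero-mean circularly-symmetric complex Gaussian (ZMCSCG) variable of variance $p$, and $W_A,W_B$ ZMCSCG with variances $\sigma_A^2,\sigma_B^2>0$, mutually independent and independent of $H$. Define $\hat H_A=H+W_A$, $\hat H_B=H+W_B$ and envelopes $\hat R_A=|\hat H_A|$, $\hat R_B=|\hat H_B|$. Mutual information is in bits; $e$ denotes Euler's number. *)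

theory Defs
  imports "HOL-Probability.Probability"
begin

text \<open>Zero-mean circularly-symmetric complex Gaussian of variance v (v > 0):
  density exp(-|z|^2/v)/(pi v) with respect to Lebesgue measure on the complex plane.\<close>
definition zmcscg :: "real \<Rightarrow> complex measure" where
  "zmcscg v = density lborel (\<lambda>z. ennreal (exp (- (cmod z)\<^sup>2 / v) / (pi * v)))"

text \<open>Joint law of (H, W_A, W_B): independent, as a product measure.\<close>
definition chan_space :: "real \<Rightarrow> real \<Rightarrow> real \<Rightarrow> (complex \<times> complex \<times> complex) measure" where
  "chan_space p sA2 sB2 = zmcscg p \<Otimes>\<^sub>M (zmcscg sA2 \<Otimes>\<^sub>M zmcscg sB2)"

text \<open>Envelopes of the estimates \<open>\<hat>H_A = H + W_A\<close>, \<open>\<hat>H_B = H + W_B\<close>.\<close>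
definition env_A :: "complex \<times> complex \<times> complex \<Rightarrow> real" where
  "env_A w = cmod (fst w + fst (snd w))"

definition env_B :: "complex \<times> complex \<times> complex \<Rightarrow> real" where
  "env_B w = cmod (fst w + snd (snd w))"

definition env_MI :: "real \<Rightarrow> real \<Rightarrow> real \<Rightarrow> real" where
  "env_MI p sA2 sB2 =
     prob_space.mutual_information (chan_space p sA2 sB2) 2 borel borel env_A env_B"

definition chi_const :: real where
  "chi_const = (1/2) * log 2 (4 * pi / exp (1 + euler_mascheroni))"

end

theory Submission
  imports Defs "HOL-Real_Asymp.Real_Asymp"
begin

text \<open>
  The pair \<open>(H + W\<^sub>A, H + W\<^sub>B)\<close> has an explicit Gaussian density with respect to the product of its
  marginals. Averaging this density over rotations of one coordinate gives the likelihood ratio of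
  the envelopes, which is a Gaussian factor times \<open>I\<^sub>0(c R\<^sub>A R\<^sub>B)\<close> with
  \<open>c = 2p / ((p + \<sigma>\<^sub>A\<^sup>2)(p + \<sigma>\<^sub>B\<^sup>2) - p\<^sup>2)\<close>. The mutual information is the expectation of its logarithm.
  Since \<open>ln I\<^sub>0(t) = t - ln(2\<pi>t)/2 + o(1)\<close>, only three quantities matter:
  \<open>E R\<^sup>2\<close>, \<open>E ln R\<close>, which produces the Euler--Mascheroni constant through \<open>\<Gamma>'(1) = -\<gamma>\<close>,
  and \<open>E R\<^sub>A R\<^sub>B\<close> up to \<open>o(\<sigma>\<^sub>A\<^sup>2)\<close>. The last one is read off from \<open>E (R\<^sub>A - R\<^sub>B)\<^sup>2\<close>:
  to first order \<open>R\<^sub>A - R\<^sub>B\<close> is the component of \<open>W\<^sub>A - W\<^sub>B\<close> along \<open>H\<close>, of variance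
  \<open>(\<sigma>\<^sub>A\<^sup>2 + \<sigma>\<^sub>B\<^sup>2)/2\<close>. The remainder in the asymptotics of \<open>I\<^sub>0\<close> is controlled by \<open>\<epsilon> + C/\<surd>t\<close>, and
  \<open>E (R\<^sub>A R\<^sub>B)\<^sup>-\<^sup>1\<^sup>/\<^sup>2\<close> stays bounded.
\<close>

subsection \<open>Lebesgue measure on the complex plane\<close>

text \<open>Both measures give an open box the product of its side lengths, and by
  \<open>lborel_eqI\<close> this determines Lebesgue measure. Planar integrals thereby become
  iterated real ones.\<close>

lemma lborel_complex_eq: "(lborel :: complex measure) = distr (lborel \<Otimes>\<^sub>M lborel) borel (\<lambda>(x, y). Complex x y)"
proof (rule lborel_eqI)
  have [measurable]: "(\<lambda>(x, y). Complex x y) \<in> borel_measurable (lborel \<Otimes>\<^sub>M lborel)"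
    unfolding Complex_eq case_prod_beta by measurable
  fix l u :: complex
  assume le: "\<And>b. b \<in> Basis \<Longrightarrow> l \<bullet> b \<le> u \<bullet> b"
  then have le': "Re l \<le> Re u" "Im l \<le> Im u"
    using le[of 1] le[of \<i>] by (auto simp: Basis_complex_def)
  have eq: "(\<lambda>(x, y). Complex x y) -` box l u \<inter> space (lborel \<Otimes>\<^sub>M lborel)
      = {Re l<..<Re u} \<times> {Im l<..<Im u}"
    by (auto simp: box_def Basis_complex_def space_pair_measure)
  have "emeasure (distr (lborel \<Otimes>\<^sub>M lborel) borel (\<lambda>(x, y). Complex x y)) (box l u)
      = emeasure (lborel \<Otimes>\<^sub>M lborel) ({Re l<..<Re u} \<times> {Im l<..<Im u})"
    by (subst emeasure_distr) (simp_all only: eq, simp_all)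
  also have "\<dots> = ennreal (Re u - Re l) * ennreal (Im u - Im l)"
    using le' by (subst lborel.emeasure_pair_measure_Times) auto
  also have "\<dots> = ennreal (\<Prod>b\<in>Basis. (u - l) \<bullet> b)"
    using le' by (simp add: Basis_complex_def ennreal_mult)
  finally show "emeasure (distr (lborel \<Otimes>\<^sub>M lborel) borel (\<lambda>(x, y). Complex x y)) (box l u) =
    ennreal (\<Prod>b\<in>Basis. (u - l) \<bullet> b)" .
qed simp

lemma measurable_Complex [measurable]:
  assumes [measurable]: "f \<in> borel_measurable M" "g \<in> borel_measurable M"
  shows "(\<lambda>x. Complex (f x) (g x)) \<in> borel_measurable M"
  unfolding Complex_eq by measurable

lemma nn_integral_lborel_complex:
  fixes f :: "complex \<Rightarrow> ennreal"
  assumes [measurable]: "f \<in> borel_measurable borel"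
  shows "(\<integral>\<^sup>+z. f z \<partial>lborel) = (\<integral>\<^sup>+y. \<integral>\<^sup>+x. f (Complex x y) \<partial>lborel \<partial>lborel)"
    and "(\<integral>\<^sup>+z. f z \<partial>lborel) = (\<integral>\<^sup>+x. \<integral>\<^sup>+y. f (Complex x y) \<partial>lborel \<partial>lborel)"
proof -
  have *: "(\<integral>\<^sup>+z. f z \<partial>lborel) = (\<integral>\<^sup>+w. f (Complex (fst w) (snd w)) \<partial>(lborel \<Otimes>\<^sub>M lborel))"
    by (subst lborel_complex_eq, subst nn_integral_distr) (auto simp: case_prod_beta)
  show "(\<integral>\<^sup>+z. f z \<partial>lborel) = (\<integral>\<^sup>+x. \<integral>\<^sup>+y. f (Complex x y) \<partial>lborel \<partial>lborel)"
    unfolding * by (subst lborel.nn_integral_fst[symmetric]) auto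
  show "(\<integral>\<^sup>+z. f z \<partial>lborel) = (\<integral>\<^sup>+y. \<integral>\<^sup>+x. f (Complex x y) \<partial>lborel \<partial>lborel)"
    unfolding * by (subst lborel_pair.nn_integral_snd[symmetric]) auto
qed

section \<open>Invariance under translations, shears and rotations\<close>

lemma nn_integral_lborel_translate:
  fixes f :: "'a::euclidean_space \<Rightarrow> ennreal"
  assumes [measurable]: "f \<in> borel_measurable borel"
  shows "(\<integral>\<^sup>+z. f (c + z) \<partial>lborel) = (\<integral>\<^sup>+z. f z \<partial>lborel)"
  by (subst (2) lborel_distr_plus[of c, symmetric], subst nn_integral_distr) auto

text \<open>With the other coordinate held fixed, a shear is a translation of a line, so the
  matching order of integration reduces it to translation invariance.\<close>

lemma nn_integral_complex_shear:
  fixes f :: "complex \<Rightarrow> ennreal"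
  assumes [measurable]: "f \<in> borel_measurable borel"
  shows "(\<integral>\<^sup>+z. f (Complex (Re z + t * Im z) (Im z)) \<partial>lborel) = (\<integral>\<^sup>+z. f z \<partial>lborel)"
    and "(\<integral>\<^sup>+z. f (Complex (Re z) (Im z + t * Re z)) \<partial>lborel) = (\<integral>\<^sup>+z. f z \<partial>lborel)"
proof -
  have "(\<integral>\<^sup>+x. f (Complex (x + t * y) y) \<partial>lborel) = (\<integral>\<^sup>+x. f (Complex x y) \<partial>lborel)" for y
    using nn_integral_lborel_translate[of "\<lambda>x. f (Complex x y)" "t * y"] by (simp add: add.commute)
  then show "(\<integral>\<^sup>+z. f (Complex (Re z + t * Im z) (Im z)) \<partial>lborel) = (\<integral>\<^sup>+z. f z \<partial>lborel)"
    by (simp add: nn_integral_lborel_complex(1))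
  have "(\<integral>\<^sup>+y. f (Complex x (y + t * x)) \<partial>lborel) = (\<integral>\<^sup>+y. f (Complex x y) \<partial>lborel)" for x
    using nn_integral_lborel_translate[of "\<lambda>y. f (Complex x y)" "t * x"] by (simp add: add.commute)
  then show "(\<integral>\<^sup>+z. f (Complex (Re z) (Im z + t * Re z)) \<partial>lborel) = (\<integral>\<^sup>+z. f z \<partial>lborel)"
    by (simp add: nn_integral_lborel_complex(2))
qed

text \<open>A rotation other than the half turn is a product of three shears; the half turn is
  reached by composing the rotation by a square root with itself.\<close>

lemma nn_integral_complex_rotate:
  fixes f :: "complex \<Rightarrow> ennreal"
  assumes [measurable]: "f \<in> borel_measurable borel" and w: "cmod w = 1"
  shows "(\<integral>\<^sup>+z. f (w * z) \<partial>lborel) = (\<integral>\<^sup>+z. f z \<partial>lborel)"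
proof -
  have rot: "(\<integral>\<^sup>+z. g (u * z) \<partial>lborel) = (\<integral>\<^sup>+z. g z \<partial>lborel)"
    if [measurable]: "g \<in> borel_measurable borel" and u: "cmod u = 1" "u \<noteq> -1"
    for u and g :: "complex \<Rightarrow> ennreal"
  proof -
    define c s where "c = Re u" and "s = Im u"
    \<comment> \<open>\<open>t\<close> is minus the tangent of half the rotation angle, the slope of
      the two outer shears; it is finite because \<open>u\<close> is not -1.\<close>
    define t where "t = - s / (1 + c)"
    have cs: "c\<^sup>2 + s\<^sup>2 = 1"
      using u by (simp add: cmod_def c_def s_def)
    have "c \<noteq> -1"
      using u cs by (auto simp: c_def s_def complex_eq_iff)
    then have t: "t * (1 + c) = - s"
      by (simp add: t_def)
    have "(1 + s * t - c) * (1 + c) = 0"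
      using t cs by algebra
    then have c: "c = 1 + s * t"
      using \<open>c \<noteq> -1\<close> by simp
    have s: "t + t * (1 + s * t) = - s"
      using t unfolding c by (simp add: algebra_simps)
    have s1: "(1 + s * t) * t + t = - s" using s by algebra
    let ?S = "\<lambda>z. Complex (Re z + t * Im z) (Im z)"
    let ?T = "\<lambda>z. Complex (Re z) (Im z + s * Re z)"
    have eq: "u * z = ?S (?T (?S z))" for z
    proof (rule complex_eqI)
      have "Re (u * z) = (1 + s * t) * Re z - s * Im z"
        using c by (simp add: c_def s_def)
      also have "\<dots> = Re (?S (?T (?S z)))"
        using s1 unfolding complex.sel by algebra
      finally show "Re (u * z) = Re (?S (?T (?S z)))" .
      have "Im (u * z) = (1 + s * t) * Im z + s * Re z"
        using c by (simp add: c_def s_def)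
      also have "\<dots> = Im (?S (?T (?S z)))"
        unfolding complex.sel by algebra
      finally show "Im (u * z) = Im (?S (?T (?S z)))" .
    qed
    have "(\<integral>\<^sup>+z. g (?S (?T (?S z))) \<partial>lborel) = (\<integral>\<^sup>+z. g (?S (?T z)) \<partial>lborel)"
      using nn_integral_complex_shear(1)[of "\<lambda>z. g (?S (?T z))" t] by simp
    also have "\<dots> = (\<integral>\<^sup>+z. g (?S z) \<partial>lborel)"
      using nn_integral_complex_shear(2)[of "\<lambda>z. g (?S z)" s] by simp
    also have "\<dots> = (\<integral>\<^sup>+z. g z \<partial>lborel)"
      by (rule nn_integral_complex_shear(1)) simp
    finally show ?thesis
      by (simp only: eq)
  qed
  \<comment> \<open>The principal branch keeps the square root away from the excluded value
    -1.\<close>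
  have "Re (csqrt w) \<ge> 0"
    using csqrt_principal[of w] by auto
  then have r: "cmod (csqrt w) = 1" "csqrt w \<noteq> -1"
    using w by (auto simp del: csqrt.sel)
  have "w * z = csqrt w * (csqrt w * z)" for z
    by (metis mult.assoc power2_csqrt power2_eq_square)
  then have "(\<integral>\<^sup>+z. f (w * z) \<partial>lborel) = (\<integral>\<^sup>+z. f (csqrt w * (csqrt w * z)) \<partial>lborel)"
    by presburger
  also have "\<dots> = (\<integral>\<^sup>+z. f z \<partial>lborel)"
    using rot[of "\<lambda>z. f (csqrt w * z)", OF _ r] rot[of f, OF _ r] by simp
  finally show ?thesis .
qed

section \<open>Integrals of radial functions\<close>

text \<open>A disc of radius r has area pi times r squared, so the squared modulus pushes area to pi
  times Lebesgue measure on a half-line. The sign is reversed because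
  \<open>measure_eqI_lessThan\<close> compares finite masses of upper rays, and discs have finite
  area while their complements do not.\<close>

lemma distr_lborel_neg_cmod_square:
  "distr lborel borel (\<lambda>z::complex. - (cmod z)\<^sup>2) = density lborel (\<lambda>t. ennreal pi * indicator {..0} t)"
proof (rule measure_eqI_lessThan)
  have M: "emeasure (distr lborel borel (\<lambda>z::complex. - (cmod z)\<^sup>2)) {x<..} = ennreal (pi * max 0 (- x))" for x
  proof (cases "x < 0")
    case True
    have "(\<lambda>z::complex. - (cmod z)\<^sup>2) -` {x<..} = ball 0 (sqrt (- x))"
    proof (intro set_eqI)
      fix z :: complex
      have "cmod z < sqrt (- x) \<longleftrightarrow> sqrt ((cmod z)\<^sup>2) < sqrt (- x)"
        by simp
      also have "\<dots> \<longleftrightarrow> (cmod z)\<^sup>2 < - x"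
        by (rule real_sqrt_less_iff)
      finally show "z \<in> (\<lambda>z. - (cmod z)\<^sup>2) -` {x<..} \<longleftrightarrow> z \<in> ball 0 (sqrt (- x))"
        by auto
    qed
    then have "emeasure (distr lborel borel (\<lambda>z::complex. - (cmod z)\<^sup>2)) {x<..} = emeasure lborel (ball (0::complex) (sqrt (- x)))"
      by (subst emeasure_distr) auto
    also have "\<dots> = ennreal (pi * max 0 (- x))"
      using True by (subst emeasure_ball) (auto simp: unit_ball_vol_2 max_def)
    finally show ?thesis .
  next
    case False
    then have "\<not> x < - (cmod z)\<^sup>2" for z :: complex
      using zero_le_power2[of "cmod z"] by linarith
    then have "(\<lambda>z::complex. - (cmod z)\<^sup>2) -` {x<..} = {}"
      by auto
    with False show ?thesis
      by (subst emeasure_distr) auto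
  qed
  show "emeasure (distr lborel borel (\<lambda>z::complex. - (cmod z)\<^sup>2)) {x<..} < \<infinity>" for x
    by (simp add: M)
  show "emeasure (distr lborel borel (\<lambda>z::complex. - (cmod z)\<^sup>2)) {x<..}
     = emeasure (density lborel (\<lambda>t. ennreal pi * indicator {..0} t)) {x<..}" for x
  proof -
    have "emeasure (density lborel (\<lambda>t. ennreal pi * indicator {..0} t)) {x<..}
       = (\<integral>\<^sup>+t. ennreal pi * indicator {x<..0} t \<partial>lborel)"
      by (subst emeasure_density) (auto intro!: nn_integral_cong simp: indicator_def)
    also have "\<dots> = ennreal pi * ennreal (max 0 (- x))"
      by (subst nn_integral_cmult_indicator) (auto simp: max_def)
    finally show ?thesis by (simp add: M ennreal_mult)
  qed
qed simp_all

text \<open>Stands in for polar coordinates; the reflection \<open>uminus\<close> undoes the sign in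
  \<open>distr_lborel_neg_cmod_square\<close>.\<close>

lemma nn_integral_cmod_square:
  fixes f :: "real \<Rightarrow> ennreal"
  assumes [measurable]: "f \<in> borel_measurable borel"
  shows "(\<integral>\<^sup>+z. f ((cmod z)\<^sup>2) \<partial>lborel) = (\<integral>\<^sup>+t. ennreal pi * indicator {0..} t * f t \<partial>lborel)"
proof -
  have "(\<integral>\<^sup>+z. f ((cmod z)\<^sup>2) \<partial>lborel) = (\<integral>\<^sup>+t. f (- t) \<partial>distr lborel borel (\<lambda>z::complex. - (cmod z)\<^sup>2))"
    by (subst nn_integral_distr) auto
  also have "\<dots> = (\<integral>\<^sup>+t. ennreal pi * indicator {..0} t * f (- t) \<partial>lborel)"
    unfolding distr_lborel_neg_cmod_square by (subst nn_integral_density) auto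
  also have "\<dots> = (\<integral>\<^sup>+t. ennreal pi * indicator {..0} t * f (- t) \<partial>distr lborel borel uminus)"
    by (simp add: lborel_distr_uminus)
  also have "\<dots> = (\<integral>\<^sup>+t. ennreal pi * indicator {0..} t * f t \<partial>lborel)"
    by (subst nn_integral_distr) (auto intro!: nn_integral_cong simp: indicator_def)
  finally show ?thesis .
qed

subsection \<open>Circularly-symmetric Gaussian measures\<close>

lemma sets_zmcscg [simp, measurable_cong]: "sets (zmcscg v) = sets borel"
  by (simp add: zmcscg_def)

lemma space_zmcscg [simp]: "space (zmcscg v) = UNIV"
  by (simp add: zmcscg_def)

lemma nn_integral_zmcscg:
  fixes f :: "complex \<Rightarrow> ennreal"
  assumes [measurable]: "f \<in> borel_measurable borel"
  shows "(\<integral>\<^sup>+z. f z \<partial>zmcscg v) = (\<integral>\<^sup>+z. ennreal (exp (- (cmod z)\<^sup>2 / v) / (pi * v)) * f z \<partial>lborel)"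
  unfolding zmcscg_def by (rule nn_integral_density) auto

lemma nn_integral_zmcscg_rotate:
  fixes f :: "complex \<Rightarrow> ennreal"
  assumes [measurable]: "f \<in> borel_measurable borel" and "cmod w = 1"
  shows "(\<integral>\<^sup>+z. f (w * z) \<partial>zmcscg v) = (\<integral>\<^sup>+z. f z \<partial>zmcscg v)"
  using nn_integral_complex_rotate[of "\<lambda>z. ennreal (exp (- (cmod z)\<^sup>2 / v) / (pi * v)) * f z" w] assms
  by (simp add: nn_integral_zmcscg norm_mult)

lemma distr_zmcscg_rotate:
  assumes "cmod w = 1"
  shows "distr (zmcscg v) borel ((*) w) = zmcscg v"
proof (rule measure_eqI)
  fix A assume "A \<in> sets (distr (zmcscg v) borel ((*) w))"
  then have [measurable]: "A \<in> sets borel" by simp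
  have "emeasure (distr (zmcscg v) borel ((*) w)) A = (\<integral>\<^sup>+z. indicator A z \<partial>distr (zmcscg v) borel ((*) w))"
    by simp
  also have "\<dots> = (\<integral>\<^sup>+z. indicator A (w * z) \<partial>zmcscg v)"
    by (subst nn_integral_distr) auto
  also have "\<dots> = emeasure (zmcscg v) A"
    using assms by (subst nn_integral_zmcscg_rotate) auto
  finally show "emeasure (distr (zmcscg v) borel ((*) w)) A = emeasure (zmcscg v) A" .
qed simp

text \<open>The factor pi of the radial substitution cancels the one in the Gaussian normalization,
  leaving an exponential law of mean \<open>v\<close>.\<close>

lemma distr_zmcscg_cmod_square:
  assumes v: "v > 0"
  shows "distr (zmcscg v) borel (\<lambda>z. (cmod z)\<^sup>2) = density lborel (exponential_density (1 / v))"
proof (rule measure_eqI)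
  fix A assume "A \<in> sets (distr (zmcscg v) borel (\<lambda>z. (cmod z)\<^sup>2))"
  then have [measurable]: "A \<in> sets borel" by simp
  have "emeasure (distr (zmcscg v) borel (\<lambda>z. (cmod z)\<^sup>2)) A = (\<integral>\<^sup>+z. indicator A z \<partial>distr (zmcscg v) borel (\<lambda>z. (cmod z)\<^sup>2))"
    by simp
  also have "\<dots> = (\<integral>\<^sup>+z. indicator A ((cmod z)\<^sup>2) \<partial>zmcscg v)"
    by (subst nn_integral_distr) auto
  also have "\<dots> = (\<integral>\<^sup>+t. ennreal pi * indicator {0..} t * (ennreal (exp (- t / v) / (pi * v)) * indicator A t) \<partial>lborel)"
    by (subst nn_integral_zmcscg, simp)
       (rule nn_integral_cmod_square[of "\<lambda>t. ennreal (exp (- t / v) / (pi * v)) * indicator A t"], simp)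
  also have "\<dots> = (\<integral>\<^sup>+t. ennreal (exponential_density (1 / v) t) * indicator A t \<partial>lborel)"
    using v by (intro nn_integral_cong) (auto simp: exponential_density_def indicator_def ennreal_mult[symmetric])
  also have "\<dots> = emeasure (density lborel (exponential_density (1 / v))) A"
    by (subst emeasure_density) auto
  finally show "emeasure (distr (zmcscg v) borel (\<lambda>z. (cmod z)\<^sup>2)) A = emeasure (density lborel (exponential_density (1 / v))) A" .
qed simp

text \<open>A pushforward preserves total mass, so the known mass of the exponential law spares the
  computation of a Gaussian integral.\<close>

lemma prob_space_zmcscg:
  assumes v: "v > 0"
  shows "prob_space (zmcscg v)"
proof (rule prob_space_distrD)
  show "prob_space (distr (zmcscg v) borel (\<lambda>z. (cmod z)\<^sup>2))"
    unfolding distr_zmcscg_cmod_square[OF v] using v by (intro prob_space_exponential_density) simp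
qed simp

text \<open>The Jacobian of the dilation is \<open>c\<^sup>2\<close>, since the plane has real
  dimension 2, and it is exactly what changes the normalizing factor. This lets Gaussians of all
  variances live on one space.\<close>

lemma zmcscg_scale:
  assumes v: "v > 0" and c: "c > 0"
  shows "distr (zmcscg v) borel ((*\<^sub>R) c) = zmcscg (c\<^sup>2 * v)"
proof (rule measure_eqI)
  fix A assume "A \<in> sets (distr (zmcscg v) borel ((*\<^sub>R) c))"
  then have [measurable]: "A \<in> sets borel" by simp
  have "emeasure (zmcscg (c\<^sup>2 * v)) A = (\<integral>\<^sup>+z. ennreal (exp (- (cmod z)\<^sup>2 / (c\<^sup>2 * v)) / (pi * (c\<^sup>2 * v))) * indicator A z \<partial>lborel)"
    by (simp add: zmcscg_def emeasure_density)
  also have "\<dots> = (\<integral>\<^sup>+z. ennreal (exp (- (cmod z)\<^sup>2 / (c\<^sup>2 * v)) / (pi * (c\<^sup>2 * v))) * indicator A z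
      \<partial>density (distr lborel borel (\<lambda>x. 0 + c *\<^sub>R x)) (\<lambda>_. \<bar>c\<bar>^DIM(complex)))"
    using c by (subst lborel_affine[of c 0]) auto
  also have "\<dots> = (\<integral>\<^sup>+z. ennreal (c^2) * (ennreal (exp (- (cmod (c *\<^sub>R z))\<^sup>2 / (c\<^sup>2 * v)) / (pi * (c\<^sup>2 * v))) * indicator A (c *\<^sub>R z)) \<partial>lborel)"
    by (subst nn_integral_density, simp, simp, subst nn_integral_distr) auto
  also have "\<dots> = (\<integral>\<^sup>+z. ennreal (exp (- (cmod z)\<^sup>2 / v) / (pi * v)) * indicator A (c *\<^sub>R z) \<partial>lborel)"
  proof (intro nn_integral_cong)
    fix z :: complex
    have "(cmod (c *\<^sub>R z))\<^sup>2 = c\<^sup>2 * (cmod z)\<^sup>2"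
      by (simp add: power_mult_distrib)
    then have "c\<^sup>2 * (exp (- (cmod (c *\<^sub>R z))\<^sup>2 / (c\<^sup>2 * v)) / (pi * (c\<^sup>2 * v))) = exp (- (cmod z)\<^sup>2 / v) / (pi * v)"
      using c by simp
    then show "ennreal (c\<^sup>2) * (ennreal (exp (- (cmod (c *\<^sub>R z))\<^sup>2 / (c\<^sup>2 * v)) / (pi * (c\<^sup>2 * v))) * indicator A (c *\<^sub>R z))
      = ennreal (exp (- (cmod z)\<^sup>2 / v) / (pi * v)) * indicator A (c *\<^sub>R z)"
      using v by (simp only: mult.assoc[symmetric] ennreal_mult'[OF zero_le_power2, symmetric])
  qed
  also have "\<dots> = (\<integral>\<^sup>+z. indicator A (c *\<^sub>R z) \<partial>zmcscg v)"
    by (subst nn_integral_zmcscg) auto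
  also have "\<dots> = (\<integral>\<^sup>+z. indicator A z \<partial>distr (zmcscg v) borel ((*\<^sub>R) c))"
    by (subst nn_integral_distr) auto
  also have "\<dots> = emeasure (distr (zmcscg v) borel ((*\<^sub>R) c)) A" by simp
  finally show "emeasure (distr (zmcscg v) borel ((*\<^sub>R) c)) A = emeasure (zmcscg (c\<^sup>2 * v)) A" by simp
qed simp

lemma measurable_cnj [measurable]: "cnj \<in> borel_measurable borel"
  by (intro borel_measurable_continuous_onI continuous_intros)

lemma measurable_cis [measurable]: "cis \<in> borel_measurable borel"
  by (intro borel_measurable_continuous_onI continuous_intros)

section \<open>Products of Gaussian densities and sums of independent Gaussians\<close>

text \<open>The density inside \<open>zmcscg\<close> gets a name because it is also evaluated at
  shifted arguments.\<close>

definition cgauss :: "real \<Rightarrow> complex \<Rightarrow> real" where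
  "cgauss v z = exp (- (cmod z)\<^sup>2 / v) / (pi * v)"

lemma cgauss_nonneg: "v > 0 \<Longrightarrow> cgauss v z \<ge> 0"
  by (simp add: cgauss_def)

lemma measurable_cgauss [measurable]: "cgauss v \<in> borel_measurable borel"
  unfolding cgauss_def by measurable

lemma zmcscg_eq: "zmcscg v = density lborel (\<lambda>z. ennreal (cgauss v z))"
  by (simp add: zmcscg_def cgauss_def)

lemma nn_integral_zmcscg_cgauss:
  fixes f :: "complex \<Rightarrow> ennreal"
  assumes [measurable]: "f \<in> borel_measurable borel"
  shows "(\<integral>\<^sup>+z. f z \<partial>zmcscg v) = (\<integral>\<^sup>+z. ennreal (cgauss v z) * f z \<partial>lborel)"
  by (simp add: nn_integral_zmcscg cgauss_def)

lemma nn_integral_cgauss_translate: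
  assumes "v > 0"
  shows "(\<integral>\<^sup>+z. ennreal (cgauss v (z - m)) \<partial>lborel) = 1"
proof -
  interpret prob_space "zmcscg v" using assms by (rule prob_space_zmcscg)
  have "(\<integral>\<^sup>+z. ennreal (cgauss v (z - m)) \<partial>lborel) = (\<integral>\<^sup>+z. ennreal (cgauss v z) \<partial>lborel)"
    using nn_integral_lborel_translate[of "\<lambda>z. ennreal (cgauss v z)" "-m"] by simp
  also have "\<dots> = emeasure (zmcscg v) (space (zmcscg v))"
    by (subst zmcscg_eq, subst emeasure_density) auto
  finally show ?thesis by (simp only: emeasure_space_1)
qed

text \<open>Completing the square: the posterior of \<open>h\<close> given \<open>u = h + w\<close> is again Gaussian.\<close>

lemma cgauss_mult:
  assumes "a > 0" "b > 0"
  shows "cgauss a h * cgauss b (u - h) = cgauss (a + b) u * cgauss (a * b / (a + b)) (h - (a / (a + b)) *\<^sub>R u)"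
proof -
  have sq: "(cmod h)\<^sup>2 / a + (cmod (u - h))\<^sup>2 / b
      = (cmod u)\<^sup>2 / (a + b) + (cmod (h - (a / (a + b)) *\<^sub>R u))\<^sup>2 / (a * b / (a + b))"
  proof -
    \<comment> \<open>Squared moduli split into coordinates, so a real identity, applied to
      \<open>Re\<close> and \<open>Im\<close>, suffices. Dividing out \<open>a + b\<close> leaves
      the single weight \<open>k\<close>.\<close>
    have *: "x\<^sup>2 / a + (y - x)\<^sup>2 / b = y\<^sup>2 / (a + b) + (x - (a / (a + b)) * y)\<^sup>2 / (a * b / (a + b))" for x y :: real
    proof -
      define k where "k = a / (a + b)"
      have k: "k > 0" "1 - k > 0" using assms by (auto simp: k_def field_simps)
      have ab: "a = k * (a + b)" "b = (1 - k) * (a + b)"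
        using assms by (auto simp: k_def field_simps)
      have "1 - k = b / (a + b)"
        using assms by (simp add: k_def field_simps)
      then have ab3: "a * b / (a + b) = (k * (1 - k)) * (a + b)"
        using assms by (simp add: k_def)
      have "x\<^sup>2 / k + (y - x)\<^sup>2 / (1 - k) = y\<^sup>2 + (x - k * y)\<^sup>2 / (k * (1 - k))"
        using k by (simp add: field_simps power2_eq_square)
      then have "x\<^sup>2 / k / (a + b) + (y - x)\<^sup>2 / (1 - k) / (a + b)
          = y\<^sup>2 / (a + b) + (x - k * y)\<^sup>2 / (k * (1 - k)) / (a + b)"
        by (metis add_divide_distrib)
      moreover have "x\<^sup>2 / a = x\<^sup>2 / k / (a + b)" "(y - x)\<^sup>2 / b = (y - x)\<^sup>2 / (1 - k) / (a + b)"
        using ab(1,2) by (metis divide_divide_eq_left)+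
      ultimately show ?thesis
        unfolding ab3 k_def[symmetric] by (simp only: divide_divide_eq_left)
    qed
    show ?thesis
      using *[of "Re h" "Re u"] *[of "Im h" "Im u"] by (simp add: cmod_power2 add_divide_distrib distrib_right)
  qed
  have prod: "cgauss x y * cgauss x' y' = exp (- ((cmod y)\<^sup>2 / x + (cmod y')\<^sup>2 / x')) / (pi * x * (pi * x'))" for x x' y y'
    by (simp add: cgauss_def exp_add[symmetric])
  have "pi * (a + b) * (pi * (a * b / (a + b))) = pi * a * (pi * b)"
    using assms by simp
  then show ?thesis
    unfolding prod sq by (simp only:)
qed

text \<open>After the square is completed, the posterior density of \<open>h\<close> integrates to
  one and only the density of the sum remains.\<close>

lemma nn_integral_zmcscg_add:
  fixes f :: "complex \<Rightarrow> ennreal"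
  assumes [measurable]: "f \<in> borel_measurable borel" and ab: "a > 0" "b > 0"
  shows "(\<integral>\<^sup>+h. \<integral>\<^sup>+w. f (h + w) \<partial>zmcscg b \<partial>zmcscg a) = (\<integral>\<^sup>+u. f u \<partial>zmcscg (a + b))"
proof -
  have "(\<integral>\<^sup>+w. f (h + w) \<partial>zmcscg b) = (\<integral>\<^sup>+u. ennreal (cgauss b (u - h)) * f u \<partial>lborel)" for h
    using nn_integral_lborel_translate[of "\<lambda>u. ennreal (cgauss b (u - h)) * f u" h]
    by (simp add: nn_integral_zmcscg_cgauss)
  then have "(\<integral>\<^sup>+h. \<integral>\<^sup>+w. f (h + w) \<partial>zmcscg b \<partial>zmcscg a)
      = (\<integral>\<^sup>+h. ennreal (cgauss a h) * (\<integral>\<^sup>+u. ennreal (cgauss b (u - h)) * f u \<partial>lborel) \<partial>lborel)"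
    by (simp add: nn_integral_zmcscg_cgauss)
  also have "\<dots> = (\<integral>\<^sup>+h. \<integral>\<^sup>+u. ennreal (cgauss a h * cgauss b (u - h)) * f u \<partial>lborel \<partial>lborel)"
    using ab by (simp add: nn_integral_cmult[symmetric] ennreal_mult cgauss_nonneg mult.assoc)
  also have "\<dots> = (\<integral>\<^sup>+u. \<integral>\<^sup>+h. ennreal (cgauss a h * cgauss b (u - h)) * f u \<partial>lborel \<partial>lborel)"
    by (rule lborel_pair.Fubini') measurable
  also have "\<dots> = (\<integral>\<^sup>+u. ennreal (cgauss (a + b) u) * f u \<partial>lborel)"
  proof (rule nn_integral_cong)
    fix u
    have "(\<integral>\<^sup>+h. ennreal (cgauss a h * cgauss b (u - h)) * f u \<partial>lborel)
       = (\<integral>\<^sup>+h. (ennreal (cgauss (a + b) u) * f u) * ennreal (cgauss (a * b / (a + b)) (h - (a / (a + b)) *\<^sub>R u)) \<partial>lborel)"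
      using ab by (simp add: cgauss_mult ennreal_mult cgauss_nonneg mult_ac)
    also have "\<dots> = ennreal (cgauss (a + b) u) * f u"
      using ab by (subst nn_integral_cmult) (simp_all add: nn_integral_cgauss_translate)
    finally show "(\<integral>\<^sup>+h. ennreal (cgauss a h * cgauss b (u - h)) * f u \<partial>lborel) = ennreal (cgauss (a + b) u) * f u" .
  qed
  also have "\<dots> = (\<integral>\<^sup>+u. f u \<partial>zmcscg (a + b))"
    by (simp add: nn_integral_zmcscg_cgauss)
  finally show ?thesis .
qed

text \<open>The square is completed twice, first for \<open>h\<close> and \<open>u\<close>, then for
  \<open>h\<close> and \<open>v\<close>. Integrating \<open>h\<close> out leaves the law of
  \<open>u\<close> and the Gaussian conditional density of \<open>v\<close> given
  \<open>u\<close>.\<close>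

lemma nn_integral_zmcscg_add_pair:
  fixes f :: "complex \<Rightarrow> complex \<Rightarrow> ennreal"
  assumes f[measurable]: "case_prod f \<in> borel_measurable (borel \<Otimes>\<^sub>M borel)"
    and pos: "p > 0" "a > 0" "b > 0"
  shows "(\<integral>\<^sup>+h. \<integral>\<^sup>+w. \<integral>\<^sup>+z. f (h + w) (h + z) \<partial>zmcscg b \<partial>zmcscg a \<partial>zmcscg p)
    = (\<integral>\<^sup>+u. \<integral>\<^sup>+v. ennreal (cgauss (p * a / (p + a) + b) (v - (p / (p + a)) *\<^sub>R u)) * f u v \<partial>lborel \<partial>zmcscg (p + a))"
    (is "?L = ?R")
proof -
  \<comment> \<open>\<open>r\<close> and \<open>m u\<close> are the variance and the mean of the
    common component given the first estimate \<open>u\<close>.\<close>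
  define r where "r = p * a / (p + a)"
  define m where "m = (\<lambda>u::complex. (p / (p + a)) *\<^sub>R u)"
  have [measurable]: "m \<in> borel_measurable borel" unfolding m_def by measurable
  have r: "r > 0" unfolding r_def using pos by simp
  have inner: "(\<integral>\<^sup>+w. \<integral>\<^sup>+z. f (h + w) (h + z) \<partial>zmcscg b \<partial>zmcscg a)
      = (\<integral>\<^sup>+u. \<integral>\<^sup>+v. ennreal (cgauss a (u - h) * cgauss b (v - h)) * f u v \<partial>lborel \<partial>lborel)" for h
  proof -
    have "(\<integral>\<^sup>+z. f u (h + z) \<partial>zmcscg b) = (\<integral>\<^sup>+v. ennreal (cgauss b (v - h)) * f u v \<partial>lborel)" for u
      using nn_integral_lborel_translate[of "\<lambda>v. ennreal (cgauss b (v - h)) * f u v" h]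
      by (simp add: nn_integral_zmcscg_cgauss)
    then have "(\<integral>\<^sup>+w. \<integral>\<^sup>+z. f (h + w) (h + z) \<partial>zmcscg b \<partial>zmcscg a)
       = (\<integral>\<^sup>+w. ennreal (cgauss a w) * (\<integral>\<^sup>+v. ennreal (cgauss b (v - h)) * f (h + w) v \<partial>lborel) \<partial>lborel)"
      by (simp add: nn_integral_zmcscg_cgauss)
    also have "\<dots> = (\<integral>\<^sup>+u. ennreal (cgauss a (u - h)) * (\<integral>\<^sup>+v. ennreal (cgauss b (v - h)) * f u v \<partial>lborel) \<partial>lborel)"
      using nn_integral_lborel_translate[of "\<lambda>u. ennreal (cgauss a (u - h)) * (\<integral>\<^sup>+v. ennreal (cgauss b (v - h)) * f u v \<partial>lborel)" h]
      by simp
    also have "\<dots> = (\<integral>\<^sup>+u. \<integral>\<^sup>+v. ennreal (cgauss a (u - h) * cgauss b (v - h)) * f u v \<partial>lborel \<partial>lborel)"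
      using pos by (simp add: nn_integral_cmult[symmetric] ennreal_mult cgauss_nonneg mult.assoc)
    finally show ?thesis .
  qed
  have split: "cgauss p h * (cgauss a (u - h) * cgauss b (v - h))
     = (cgauss (p + a) u * cgauss (r + b) (v - m u)) * cgauss (r * b / (r + b)) (h - (m u + (r / (r + b)) *\<^sub>R (v - m u)))" for h u v
  proof -
    have 1: "cgauss p h * cgauss a (u - h) = cgauss (p + a) u * cgauss r (h - m u)"
      using cgauss_mult[of p a h u] pos by (simp only: r_def m_def)
    have 2: "cgauss r (h - m u) * cgauss b (v - h)
      = cgauss (r + b) (v - m u) * cgauss (r * b / (r + b)) (h - (m u + (r / (r + b)) *\<^sub>R (v - m u)))"
      using cgauss_mult[of r b "h - m u" "v - m u"] r pos by (simp add: diff_diff_eq)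
    show ?thesis
      by (simp only: mult.assoc[symmetric] 1) (simp only: mult.assoc 2)
  qed
  have "?L = (\<integral>\<^sup>+h. ennreal (cgauss p h) * (\<integral>\<^sup>+u. \<integral>\<^sup>+v. ennreal (cgauss a (u - h) * cgauss b (v - h)) * f u v \<partial>lborel \<partial>lborel) \<partial>lborel)"
    unfolding inner by (rule nn_integral_zmcscg_cgauss) measurable
  also have "\<dots> = (\<integral>\<^sup>+h. \<integral>\<^sup>+u. \<integral>\<^sup>+v. ennreal (cgauss p h * (cgauss a (u - h) * cgauss b (v - h))) * f u v \<partial>lborel \<partial>lborel \<partial>lborel)"
    using pos by (simp add: nn_integral_cmult[symmetric] ennreal_mult[of "cgauss p _"] cgauss_nonneg mult.assoc)
  also have "\<dots> = (\<integral>\<^sup>+u. \<integral>\<^sup>+h. \<integral>\<^sup>+v. ennreal (cgauss p h * (cgauss a (u - h) * cgauss b (v - h))) * f u v \<partial>lborel \<partial>lborel \<partial>lborel)"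
    by (rule lborel_pair.Fubini') measurable
  also have "\<dots> = (\<integral>\<^sup>+u. \<integral>\<^sup>+v. \<integral>\<^sup>+h. ennreal (cgauss p h * (cgauss a (u - h) * cgauss b (v - h))) * f u v \<partial>lborel \<partial>lborel \<partial>lborel)"
    by (intro nn_integral_cong lborel_pair.Fubini') measurable
  also have "\<dots> = (\<integral>\<^sup>+u. \<integral>\<^sup>+v. ennreal (cgauss (p + a) u) * (ennreal (cgauss (r + b) (v - m u)) * f u v) \<partial>lborel \<partial>lborel)"
  proof (intro nn_integral_cong)
    fix u v
    have "(\<integral>\<^sup>+h. ennreal (cgauss p h * (cgauss a (u - h) * cgauss b (v - h))) * f u v \<partial>lborel)
      = (\<integral>\<^sup>+h. (ennreal (cgauss (p + a) u) * (ennreal (cgauss (r + b) (v - m u)) * f u v))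
           * ennreal (cgauss (r * b / (r + b)) (h - (m u + (r / (r + b)) *\<^sub>R (v - m u)))) \<partial>lborel)"
      unfolding split using pos r by (simp add: ennreal_mult cgauss_nonneg mult_ac)
    also have "\<dots> = ennreal (cgauss (p + a) u) * (ennreal (cgauss (r + b) (v - m u)) * f u v)"
      using pos r by (subst nn_integral_cmult) (simp_all add: nn_integral_cgauss_translate)
    finally show "(\<integral>\<^sup>+h. ennreal (cgauss p h * (cgauss a (u - h) * cgauss b (v - h))) * f u v \<partial>lborel)
      = ennreal (cgauss (p + a) u) * (ennreal (cgauss (r + b) (v - m u)) * f u v)" .
  qed
  also have "\<dots> = (\<integral>\<^sup>+u. ennreal (cgauss (p + a) u) * (\<integral>\<^sup>+v. ennreal (cgauss (r + b) (v - m u)) * f u v \<partial>lborel) \<partial>lborel)"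
    by (simp add: nn_integral_cmult)
  also have "\<dots> = ?R"
    by (subst nn_integral_zmcscg_cgauss) (simp_all add: r_def m_def)
  finally show ?thesis .
qed

subsection \<open>Rotation averages and the Bessel function\<close>

text \<open>The modified Bessel function of the first kind of order zero, as an integral over a full
  period, the form in which rotation averages produce it.\<close>

definition bessel_I0 :: "real \<Rightarrow> real" where
  "bessel_I0 t = (\<integral>x. exp (t * cos x) * indicator {-pi..pi} x \<partial>lborel) / (2 * pi)"

lemma measurable_bessel_I0 [measurable]: "bessel_I0 \<in> borel_measurable borel"
  unfolding bessel_I0_def by measurable

text \<open>An antiderivative \<open>G\<close> turns the integral into
  \<open>G (pi - s) - G (-pi - s)\<close>. Its derivative in \<open>s\<close> vanishes because the
  endpoints are one period apart.\<close>

lemma nn_integral_exp_cos_shift: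
  "(\<integral>\<^sup>+x. ennreal (exp (t * cos (x - s))) * indicator {-pi..pi} x \<partial>lborel) = ennreal (2 * pi * bessel_I0 t)"
proof -
  define g where "g = (\<lambda>x. exp (t * cos x))"
  have [measurable]: "g \<in> borel_measurable borel" unfolding g_def by measurable
  have "isCont g x" for x
    unfolding g_def by (intro continuous_intros)
  then obtain G where "\<And>x. (G has_vector_derivative g x) (at x)"
    using einterval_antiderivative[of "-\<infinity>" "\<infinity>" g] by auto
  then have G: "(G has_real_derivative g x) (at x)" for x
    by (simp add: has_real_derivative_iff_has_vector_derivative)
  have I: "(\<integral>\<^sup>+x. ennreal (g (x - s)) * indicator {-pi..pi} x \<partial>lborel) = ennreal (G (pi - s) - G (-pi - s))" for s
  proof (rule nn_integral_FTC_Icc[where F = "\<lambda>x. G (x - s)"])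
    have "((\<lambda>x. x - s) has_real_derivative 1) (at x)" for x
      by (auto intro!: derivative_eq_intros)
    from DERIV_chain2[OF G this] show "((\<lambda>x. G (x - s)) has_real_derivative g (x - s)) (at x)" for x
      by simp
  qed (auto simp: g_def)
  have "((\<lambda>s. G (pi - s) - G (-pi - s)) has_real_derivative 0) (at s)" for s
  proof -
    have d: "((\<lambda>s. c - s) has_real_derivative -1) (at s)" for c s :: real
      by (auto intro!: derivative_eq_intros)
    have "g (- pi - s) = g (pi - s)"
      using cos_periodic[of "-pi - s"] by (simp add: g_def)
    then show ?thesis
      using DERIV_diff[OF DERIV_chain2[OF G d[of pi s]] DERIV_chain2[OF G d[of "- pi" s]]] by simp
  qed
  then have "G (pi - s) - G (-pi - s) = G (pi - 0) - G (-pi - 0)"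
    using DERIV_isconst_all[of "\<lambda>s. G (pi - s) - G (-pi - s)" s 0] by simp
  then have "(\<integral>\<^sup>+x. ennreal (g (x - s)) * indicator {-pi..pi} x \<partial>lborel)
      = (\<integral>\<^sup>+x. ennreal (g x) * indicator {-pi..pi} x \<partial>lborel)"
    using I[of s] I[of 0] by simp
  also have "\<dots> = (\<integral>\<^sup>+x. ennreal (g x * indicator {-pi..pi} x) \<partial>lborel)"
    by (intro nn_integral_cong) (simp add: indicator_def)
  also have "\<dots> = ennreal (\<integral>x. g x * indicator {-pi..pi} x \<partial>lborel)"
  proof (rule nn_integral_eq_integral)
    have "continuous_on {-pi..pi} g" unfolding g_def by (intro continuous_intros)
    from borel_integrable_atLeastAtMost'[OF this]
    show "integrable lborel (\<lambda>x. g x * indicator {-pi..pi} x)"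
      by (simp add: set_integrable_def mult.commute)
  qed (simp add: g_def)
  finally show ?thesis
    by (simp add: g_def bessel_I0_def)
qed

text \<open>\<open>Re (u * cnj v)\<close> is the inner product of two plane vectors, hence the
  product of the moduli times the cosine of the angle between them; the arguments only shift the
  integration variable.\<close>

lemma nn_integral_exp_Re_cis:
  "(\<integral>\<^sup>+x. ennreal (exp (c * Re (u * cnj (cis x * v)))) * indicator {-pi..pi} x \<partial>lborel)
    = ennreal (2 * pi * bessel_I0 (c * (cmod u * cmod v)))"
proof -
  have "Re (u * cnj (cis x * v)) = cmod u * cmod v * cos (x - (Arg u - Arg v))" for x
  proof -
    have "u = rcis (cmod u) (Arg u)" "v = rcis (cmod v) (Arg v)"
      by (simp_all add: rcis_cmod_Arg)
    then have "u * cnj (cis x * v) = rcis (cmod u) (Arg u) * cnj (cis x * rcis (cmod v) (Arg v))"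
      by simp
    also have "\<dots> = of_real (cmod u * cmod v) * (cis (Arg u) * cis (- x) * cis (- Arg v))"
      by (simp add: rcis_def cis_cnj)
    also have "\<dots> = of_real (cmod u * cmod v) * cis (Arg u - x - Arg v)"
      by (simp add: cis_mult)
    also have "Re \<dots> = cmod u * cmod v * cos (Arg u - x - Arg v)"
      by simp
    also have "cos (Arg u - x - Arg v) = cos (x - (Arg u - Arg v))"
      using cos_minus[of "x - (Arg u - Arg v)"] by (simp add: algebra_simps)
    finally show ?thesis .
  qed
  then show ?thesis
    using nn_integral_exp_cos_shift[of "c * (cmod u * cmod v)" "Arg u - Arg v"] by (simp add: mult.assoc)
qed

text \<open>The left side is unchanged when \<open>v\<close> is rotated by any \<open>cis x\<close>.
  Averaging over \<open>x\<close> and exchanging the integrals leaves an angular integral of the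
  exponential alone, since \<open>F\<close> sees only the modulus.\<close>

lemma nn_integral_zmcscg_rotation_average:
  fixes F :: "real \<Rightarrow> ennreal"
  assumes [measurable]: "F \<in> borel_measurable borel" and b: "b > 0"
  shows "(\<integral>\<^sup>+v. F (cmod v) * ennreal (exp (c * Re (u * cnj v))) \<partial>zmcscg b)
    = (\<integral>\<^sup>+v. F (cmod v) * ennreal (bessel_I0 (c * (cmod u * cmod v))) \<partial>zmcscg b)" (is "?L = ?R")
proof -
  interpret Z: prob_space "zmcscg b"
    using b by (rule prob_space_zmcscg)
  interpret pair_sigma_finite "lborel :: real measure" "zmcscg b" ..
  have rot: "(\<integral>\<^sup>+v. F (cmod v) * ennreal (exp (c * Re (u * cnj (cis x * v)))) \<partial>zmcscg b) = ?L" for x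
    using nn_integral_zmcscg_rotate[of "\<lambda>v. F (cmod v) * ennreal (exp (c * Re (u * cnj v)))" "cis x" b]
    by (simp add: norm_mult)
  have "ennreal (2 * pi) * ?L = (\<integral>\<^sup>+x. ?L * indicator {-pi..pi} x \<partial>lborel)"
    by (subst nn_integral_cmult_indicator) (simp_all add: mult.commute)
  also have "\<dots> = (\<integral>\<^sup>+x. (\<integral>\<^sup>+v. F (cmod v) * ennreal (exp (c * Re (u * cnj (cis x * v)))) \<partial>zmcscg b) * indicator {-pi..pi} x \<partial>lborel)"
    by (simp only: rot)
  also have "\<dots> = (\<integral>\<^sup>+x. \<integral>\<^sup>+v. F (cmod v) * (ennreal (exp (c * Re (u * cnj (cis x * v)))) * indicator {-pi..pi} x) \<partial>zmcscg b \<partial>lborel)"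
    by (simp add: nn_integral_multc[symmetric] mult.assoc)
  also have "\<dots> = (\<integral>\<^sup>+v. \<integral>\<^sup>+x. F (cmod v) * (ennreal (exp (c * Re (u * cnj (cis x * v)))) * indicator {-pi..pi} x) \<partial>lborel \<partial>zmcscg b)"
    by (rule Fubini'[symmetric]) measurable
  also have "\<dots> = (\<integral>\<^sup>+v. F (cmod v) * ennreal (2 * pi * bessel_I0 (c * (cmod u * cmod v))) \<partial>zmcscg b)"
    by (intro nn_integral_cong, subst nn_integral_cmult) (measurable, simp only: nn_integral_exp_Re_cis)
  also have "\<dots> = ennreal (2 * pi) * ?R"
    by (subst nn_integral_cmult[symmetric]) (simp_all add: ennreal_mult' mult_ac)
  finally show ?thesis
    by (simp add: ennreal_mult_cancel_left)
qed

subsection \<open>The likelihood ratio of the envelopes\<close>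

text \<open>The determinant of the covariance matrix of \<open>(H + W\<^sub>A, H + W\<^sub>B)\<close>.\<close>

definition cov_det :: "real \<Rightarrow> real \<Rightarrow> real \<Rightarrow> real" where
  "cov_det p a b = a * b + p * (a + b)"

lemma cov_det_pos: "p > 0 \<Longrightarrow> a > 0 \<Longrightarrow> b > 0 \<Longrightarrow> cov_det p a b > 0"
  by (simp add: cov_det_def add_pos_pos)

text \<open>The two estimates have variances \<open>p + a\<close> and \<open>p + b\<close> and
  covariance \<open>p\<close>, so this expands a two-by-two determinant.\<close>

lemma cov_det_eq: "(p + a) * (p + b) = cov_det p a b + p\<^sup>2"
  by (simp add: cov_det_def power2_eq_square algebra_simps)

text \<open>The part of the likelihood ratio of the two complex estimates that depends on their
  moduli only; the other factor involves the angle between them.\<close>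

definition env_weight :: "real \<Rightarrow> real \<Rightarrow> real \<Rightarrow> real \<Rightarrow> real \<Rightarrow> real" where
  "env_weight p a b x y = (p + a) * (p + b) / cov_det p a b
     * exp (- (p\<^sup>2 / cov_det p a b * (x\<^sup>2 / (p + a) + y\<^sup>2 / (p + b))))"

text \<open>The density of the joint law of the envelopes with respect to the product of their laws.\<close>

definition env_ratio :: "real \<Rightarrow> real \<Rightarrow> real \<Rightarrow> real \<Rightarrow> real \<Rightarrow> real" where
  "env_ratio p a b x y = env_weight p a b x y * bessel_I0 (2 * p / cov_det p a b * (x * y))"

lemma measurable_env_weight [measurable]:
  assumes [measurable]: "f \<in> borel_measurable M" "g \<in> borel_measurable M"
  shows "(\<lambda>w. env_weight p a b (f w) (g w)) \<in> borel_measurable M"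
  unfolding env_weight_def by measurable

lemma measurable_env_ratio [measurable]:
  assumes [measurable]: "f \<in> borel_measurable M" "g \<in> borel_measurable M"
  shows "(\<lambda>w. env_ratio p a b (f w) (g w)) \<in> borel_measurable M"
  unfolding env_ratio_def by measurable

text \<open>Expanding the square in the conditional density isolates the cross term
  \<open>Re (u * cnj v)\<close>, the only one that depends on the angle. The rest is the marginal
  density of \<open>v\<close> times a radial factor.\<close>

lemma cgauss_conditional:
  assumes pos: "p > 0" "a > 0" "b > 0"
  shows "cgauss (p * a / (p + a) + b) (v - (p / (p + a)) *\<^sub>R u)
    = cgauss (p + b) v * (env_weight p a b (cmod u) (cmod v) * exp (2 * p / cov_det p a b * Re (u * cnj v)))"
proof -
  define D where "D = cov_det p a b"
  define A where "A = p + a"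
  define B where "B = p + b"
  have D: "D > 0" unfolding D_def using pos by (rule cov_det_pos)
  have A: "A > 0" and B: "B > 0" using pos by (auto simp: A_def B_def)
  have AB: "A * B = D + p\<^sup>2"
    unfolding A_def B_def D_def by (rule cov_det_eq)
  have var: "p * a / (p + a) + b = D / A"
    using pos by (simp add: D_def A_def cov_det_def field_simps)
  have sq: "(cmod (v - (p / A) *\<^sub>R u))\<^sup>2 = (cmod v)\<^sup>2 - 2 * (p / A) * Re (u * cnj v) + (p / A)\<^sup>2 * (cmod u)\<^sup>2"
    unfolding cmod_power2 by (simp add: power2_eq_square algebra_simps)
  \<comment> \<open>The inverse conditional variance is the inverse marginal variance plus an
    excess; the excess goes into \<open>env_weight\<close>.\<close>
  have c1: "1 / (D / A) = 1 / B + p\<^sup>2 / D / B"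
  proof -
    have "1 / B + p\<^sup>2 / D / B = (D + p\<^sup>2) / (D * B)"
      using D B by (simp add: field_simps)
    then show ?thesis
      using D B by (simp add: AB[symmetric])
  qed
  have "- (cmod (v - (p / A) *\<^sub>R u))\<^sup>2 / (D / A)
      = - ((cmod v)\<^sup>2 * (1 / (D / A))) + 2 * p / D * Re (u * cnj v) - p\<^sup>2 / D / A * (cmod u)\<^sup>2"
    unfolding sq using D A by (simp add: field_simps power2_eq_square)
  also have "\<dots> = - (cmod v)\<^sup>2 / B + (- (p\<^sup>2 / D * ((cmod u)\<^sup>2 / A + (cmod v)\<^sup>2 / B)) + 2 * p / D * Re (u * cnj v))"
    unfolding c1 by (simp add: algebra_simps)
  finally have e: "exp (- (cmod (v - (p / A) *\<^sub>R u))\<^sup>2 / (D / A))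
     = exp (- (cmod v)\<^sup>2 / B) * (exp (- (p\<^sup>2 / D * ((cmod u)\<^sup>2 / A + (cmod v)\<^sup>2 / B))) * exp (2 * p / D * Re (u * cnj v)))"
    by (simp add: exp_add[symmetric])
  show ?thesis
    using D A B unfolding cgauss_def var env_weight_def
    by (simp only: A_def[symmetric] B_def[symmetric] D_def[symmetric] e) simp
qed

section \<open>The channel space and the laws of the envelopes\<close>

lemma prob_space_chan_space:
  assumes "p > 0" "a > 0" "b > 0"
  shows "prob_space (chan_space p a b)"
proof -
  interpret P: prob_space "zmcscg p" using assms by (intro prob_space_zmcscg)
  interpret A: prob_space "zmcscg a" using assms by (intro prob_space_zmcscg)
  interpret B: prob_space "zmcscg b" using assms by (intro prob_space_zmcscg)
  interpret AB: pair_prob_space "zmcscg a" "zmcscg b" ..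
  interpret PAB: pair_prob_space "zmcscg p" "zmcscg a \<Otimes>\<^sub>M zmcscg b" ..
  show ?thesis unfolding chan_space_def by unfold_locales
qed

lemma sets_chan_space [measurable_cong]: "sets (chan_space p a b) = sets (borel \<Otimes>\<^sub>M (borel \<Otimes>\<^sub>M borel))"
  unfolding chan_space_def by (intro sets_pair_measure_cong) auto

lemma measurable_env [measurable]:
  "env_A \<in> borel_measurable (chan_space p a b)" "env_B \<in> borel_measurable (chan_space p a b)"
  unfolding env_A_def env_B_def by measurable

lemma nn_integral_chan_space:
  assumes "p > 0" "a > 0" "b > 0" and [measurable]: "f \<in> borel_measurable (borel \<Otimes>\<^sub>M (borel \<Otimes>\<^sub>M borel))"
  shows "(\<integral>\<^sup>+w. f w \<partial>chan_space p a b) = (\<integral>\<^sup>+h. \<integral>\<^sup>+w. \<integral>\<^sup>+z. f (h, w, z) \<partial>zmcscg b \<partial>zmcscg a \<partial>zmcscg p)"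
proof -
  interpret A: prob_space "zmcscg a" using assms by (intro prob_space_zmcscg)
  interpret B: prob_space "zmcscg b" using assms by (intro prob_space_zmcscg)
  interpret AB: pair_prob_space "zmcscg a" "zmcscg b" ..
  show ?thesis
    unfolding chan_space_def
    by (simp add: AB.nn_integral_fst[symmetric] B.nn_integral_fst[symmetric])
qed

text \<open>The conditional density of \<open>v\<close> given \<open>u\<close> becomes a weighted
  marginal density. As \<open>F\<close> depends on moduli only, rotation averaging replaces the
  angular exponential by the Bessel function.\<close>

lemma nn_integral_env:
  fixes F :: "real \<Rightarrow> real \<Rightarrow> ennreal"
  assumes pos: "p > 0" "a > 0" "b > 0"
    and [measurable]: "case_prod F \<in> borel_measurable (borel \<Otimes>\<^sub>M borel)"
  shows "(\<integral>\<^sup>+w. F (env_A w) (env_B w) \<partial>chan_space p a b)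
    = (\<integral>\<^sup>+u. \<integral>\<^sup>+v. ennreal (env_ratio p a b (cmod u) (cmod v)) * F (cmod u) (cmod v) \<partial>zmcscg (p + b) \<partial>zmcscg (p + a))"
proof -
  have W: "env_weight p a b x y \<ge> 0" for x y
    unfolding env_weight_def using pos cov_det_pos[OF pos] by simp
  have "(\<integral>\<^sup>+w. F (env_A w) (env_B w) \<partial>chan_space p a b)
      = (\<integral>\<^sup>+h. \<integral>\<^sup>+w. \<integral>\<^sup>+z. F (cmod (h + w)) (cmod (h + z)) \<partial>zmcscg b \<partial>zmcscg a \<partial>zmcscg p)"
    using pos unfolding env_A_def env_B_def by (subst nn_integral_chan_space) simp_all
  also have "\<dots> = (\<integral>\<^sup>+u. \<integral>\<^sup>+v. ennreal (cgauss (p * a / (p + a) + b) (v - (p / (p + a)) *\<^sub>R u))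
       * F (cmod u) (cmod v) \<partial>lborel \<partial>zmcscg (p + a))"
    using pos by (intro nn_integral_zmcscg_add_pair) simp_all
  also have "\<dots> = (\<integral>\<^sup>+u. \<integral>\<^sup>+v. ennreal (cgauss (p + b) v) * ((F (cmod u) (cmod v) * ennreal (env_weight p a b (cmod u) (cmod v)))
       * ennreal (exp (2 * p / cov_det p a b * Re (u * cnj v)))) \<partial>lborel \<partial>zmcscg (p + a))"
    using pos W by (intro nn_integral_cong, simp only: cgauss_conditional[OF pos])
      (simp add: ennreal_mult cgauss_nonneg mult_ac)
  also have "\<dots> = (\<integral>\<^sup>+u. \<integral>\<^sup>+v. (F (cmod u) (cmod v) * ennreal (env_weight p a b (cmod u) (cmod v)))
       * ennreal (exp (2 * p / cov_det p a b * Re (u * cnj v))) \<partial>zmcscg (p + b) \<partial>zmcscg (p + a))"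
    by (intro nn_integral_cong nn_integral_zmcscg_cgauss[symmetric]) measurable
  also have "\<dots> = (\<integral>\<^sup>+u. \<integral>\<^sup>+v. (F (cmod u) (cmod v) * ennreal (env_weight p a b (cmod u) (cmod v)))
       * ennreal (bessel_I0 (2 * p / cov_det p a b * (cmod u * cmod v))) \<partial>zmcscg (p + b) \<partial>zmcscg (p + a))"
    using pos by (intro nn_integral_cong nn_integral_zmcscg_rotation_average) simp_all
  also have "\<dots> = (\<integral>\<^sup>+u. \<integral>\<^sup>+v. ennreal (env_ratio p a b (cmod u) (cmod v)) * F (cmod u) (cmod v) \<partial>zmcscg (p + b) \<partial>zmcscg (p + a))"
    using W by (intro nn_integral_cong) (simp add: env_ratio_def ennreal_mult' mult_ac)
  finally show ?thesis .
qed

text \<open>The noise that does not enter the envelope integrates to one, and the sum of the other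
  two components is Gaussian.\<close>

lemma nn_integral_env_marginal:
  fixes F :: "real \<Rightarrow> ennreal"
  assumes pos: "p > 0" "a > 0" "b > 0" and [measurable]: "F \<in> borel_measurable borel"
  shows "(\<integral>\<^sup>+w. F (env_A w) \<partial>chan_space p a b) = (\<integral>\<^sup>+u. F (cmod u) \<partial>zmcscg (p + a))"
    and "(\<integral>\<^sup>+w. F (env_B w) \<partial>chan_space p a b) = (\<integral>\<^sup>+u. F (cmod u) \<partial>zmcscg (p + b))"
proof -
  interpret A: prob_space "zmcscg a" using assms by (intro prob_space_zmcscg)
  interpret B: prob_space "zmcscg b" using assms by (intro prob_space_zmcscg)
  have "(\<integral>\<^sup>+w. F (env_A w) \<partial>chan_space p a b) = (\<integral>\<^sup>+h. \<integral>\<^sup>+w. F (cmod (h + w)) \<partial>zmcscg a \<partial>zmcscg p)"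
    using pos unfolding env_A_def by (subst nn_integral_chan_space) (simp_all add: B.emeasure_space_1[simplified])
  also have "\<dots> = (\<integral>\<^sup>+u. F (cmod u) \<partial>zmcscg (p + a))"
    using pos by (intro nn_integral_zmcscg_add) simp_all
  finally show "(\<integral>\<^sup>+w. F (env_A w) \<partial>chan_space p a b) = (\<integral>\<^sup>+u. F (cmod u) \<partial>zmcscg (p + a))" .
  have "(\<integral>\<^sup>+w. F (env_B w) \<partial>chan_space p a b) = (\<integral>\<^sup>+h. \<integral>\<^sup>+w. F (cmod (h + w)) \<partial>zmcscg b \<partial>zmcscg p)"
    using pos unfolding env_B_def by (subst nn_integral_chan_space) (simp_all add: A.emeasure_space_1[simplified])
  also have "\<dots> = (\<integral>\<^sup>+u. F (cmod u) \<partial>zmcscg (p + b))"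
    using pos by (intro nn_integral_zmcscg_add) simp_all
  finally show "(\<integral>\<^sup>+w. F (env_B w) \<partial>chan_space p a b) = (\<integral>\<^sup>+u. F (cmod u) \<partial>zmcscg (p + b))" .
qed

lemma distr_eqI_nn_integral:
  assumes [measurable]: "X \<in> M \<rightarrow>\<^sub>M N" "Y \<in> M' \<rightarrow>\<^sub>M N"
    and eq: "\<And>A. A \<in> sets N \<Longrightarrow> (\<integral>\<^sup>+w. indicator A (X w) \<partial>M) = (\<integral>\<^sup>+w. indicator A (Y w) \<partial>M')"
  shows "distr M N X = distr M' N Y"
proof (rule measure_eqI)
  fix A assume "A \<in> sets (distr M N X)"
  then have [measurable]: "A \<in> sets N" by simp
  show "emeasure (distr M N X) A = emeasure (distr M' N Y) A"
    using nn_integral_distr[of X M N "indicator A"] nn_integral_distr[of Y M' N "indicator A"] eq[of A] by simp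
qed simp

lemma distr_env:
  assumes pos: "p > 0" "a > 0" "b > 0"
  shows "distr (chan_space p a b) borel env_A = distr (zmcscg (p + a)) borel cmod"
    and "distr (chan_space p a b) borel env_B = distr (zmcscg (p + b)) borel cmod"
  using pos by (intro distr_eqI_nn_integral nn_integral_env_marginal; simp)+

lemma bessel_I0_nonneg: "bessel_I0 t \<ge> 0"
  unfolding bessel_I0_def by (intro divide_nonneg_nonneg integral_nonneg_AE) auto

lemma distr_env_pair:
  assumes pos: "p > 0" "a > 0" "b > 0"
  shows "distr (chan_space p a b) (borel \<Otimes>\<^sub>M borel) (\<lambda>w. (env_A w, env_B w))
    = density (distr (chan_space p a b) borel env_A \<Otimes>\<^sub>M distr (chan_space p a b) borel env_B)
        (\<lambda>xy. ennreal (env_ratio p a b (fst xy) (snd xy)))" (is "?L = ?R")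
proof (rule measure_eqI)
  show "sets ?L = sets ?R"
    by (simp cong: sets_pair_measure_cong)
  fix A assume "A \<in> sets ?L"
  then have [measurable]: "A \<in> sets (borel \<Otimes>\<^sub>M borel)" by simp
  interpret B: prob_space "zmcscg (p + b)" using pos by (intro prob_space_zmcscg) simp
  interpret R: prob_space "distr (zmcscg (p + b)) borel cmod" by (intro B.prob_space_distr) simp
  have "emeasure ?L A = (\<integral>\<^sup>+w. indicator A (env_A w, env_B w) \<partial>chan_space p a b)"
    using nn_integral_distr[of "\<lambda>w. (env_A w, env_B w)" "chan_space p a b" "borel \<Otimes>\<^sub>M borel" "indicator A"]
    by simp
  also have "\<dots> = (\<integral>\<^sup>+u. \<integral>\<^sup>+v. ennreal (env_ratio p a b (cmod u) (cmod v)) * indicator A (cmod u, cmod v) \<partial>zmcscg (p + b) \<partial>zmcscg (p + a))"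
    using pos by (intro nn_integral_env) simp_all
  also have "\<dots> = (\<integral>\<^sup>+x. \<integral>\<^sup>+y. ennreal (env_ratio p a b x y) * indicator A (x, y) \<partial>distr (zmcscg (p + b)) borel cmod \<partial>distr (zmcscg (p + a)) borel cmod)"
    by (subst nn_integral_distr, simp, simp, subst nn_integral_distr) simp_all
  also have "\<dots> = (\<integral>\<^sup>+xy. ennreal (env_ratio p a b (fst xy) (snd xy)) * indicator A xy
      \<partial>(distr (zmcscg (p + a)) borel cmod \<Otimes>\<^sub>M distr (zmcscg (p + b)) borel cmod))"
    by (subst R.nn_integral_fst[symmetric]) simp_all
  also have "\<dots> = emeasure ?R A"
    unfolding distr_env[OF pos] by (subst emeasure_density) simp_all
  finally show "emeasure ?L A = emeasure ?R A" .
qed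

text \<open>Mutual information is the Kullback-Leibler divergence of the joint law from the product
  of the marginals; the density in front of the logarithm is absorbed into the joint law.\<close>

lemma env_MI_eq:
  assumes pos: "p > 0" "a > 0" "b > 0"
  shows "env_MI p a b = (\<integral>w. log 2 (env_ratio p a b (env_A w) (env_B w)) \<partial>chan_space p a b)"
proof -
  interpret C: prob_space "chan_space p a b" using pos by (rule prob_space_chan_space)
  let ?f = "\<lambda>xy. env_ratio p a b (fst xy) (snd xy)"
  let ?M = "distr (chan_space p a b) borel env_A \<Otimes>\<^sub>M distr (chan_space p a b) borel env_B"
  interpret A: prob_space "distr (chan_space p a b) borel env_A" by (intro C.prob_space_distr) simp
  interpret B: prob_space "distr (chan_space p a b) borel env_B" by (intro C.prob_space_distr) simp
  interpret AB: pair_prob_space "distr (chan_space p a b) borel env_A" "distr (chan_space p a b) borel env_B" ..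
  have nn: "?f xy \<ge> 0" for xy
    using pos cov_det_pos[OF pos] bessel_I0_nonneg by (simp add: env_ratio_def env_weight_def)
  have "env_MI p a b = KL_divergence 2 ?M (density ?M ?f)"
    unfolding env_MI_def C.mutual_information_def distr_env_pair[OF pos] ..
  also have "\<dots> = (\<integral>xy. ?f xy * log 2 (?f xy) \<partial>?M)"
    using nn by (intro AB.KL_density) simp_all
  also have "\<dots> = (\<integral>xy. log 2 (?f xy) \<partial>density ?M ?f)"
    using nn by (subst integral_density) simp_all
  also have "\<dots> = (\<integral>w. log 2 (env_ratio p a b (env_A w) (env_B w)) \<partial>chan_space p a b)"
    unfolding distr_env_pair[OF pos, symmetric] by (subst integral_distr) simp_all
  finally show ?thesis .
qed

subsection \<open>Gaussian moments\<close>

lemma zmcscg_eq_distr_1: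
  assumes "v > 0"
  shows "zmcscg v = distr (zmcscg 1) borel ((*\<^sub>R) (sqrt v))"
  using zmcscg_scale[of 1 "sqrt v"] assms by simp

text \<open>At variance one the squared modulus is exponential, so its moments are Gamma integrals;
  scaling gives the general case. Negative exponents are included for the use of -1/2 as a
  dominating power.\<close>

lemma zmcscg_moment:
  assumes v: "v > 0" and s: "s > -1"
  shows "has_bochner_integral (zmcscg v) (\<lambda>z. ((cmod z)\<^sup>2) powr s) (v powr s * Gamma (1 + s))"
proof -
  have G: "Gamma (1 + s) > 0" using s by (intro Gamma_real_pos) simp
  have "(\<integral>\<^sup>+z. ennreal (((cmod z)\<^sup>2) powr s) \<partial>zmcscg 1)
      = (\<integral>\<^sup>+t. ennreal (t powr s) \<partial>distr (zmcscg 1) borel (\<lambda>z. (cmod z)\<^sup>2))"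
    by (subst nn_integral_distr) simp_all
  also have "\<dots> = (\<integral>\<^sup>+t. ennreal (exponential_density 1 t) * ennreal (t powr s) \<partial>lborel)"
    by (simp add: distr_zmcscg_cmod_square nn_integral_density)
  also have "\<dots> = (\<integral>\<^sup>+t. ennreal (indicator {0..} t * t powr (1 + s - 1) / exp t) \<partial>lborel)"
    by (intro nn_integral_cong)
       (auto simp: exponential_density_def ennreal_mult[symmetric] exp_minus field_simps)
  also have "\<dots> = ennreal (Gamma (1 + s))"
    using s by (subst Gamma_conv_nn_integral_real) simp_all
  finally have "has_bochner_integral (zmcscg 1) (\<lambda>z. ((cmod z)\<^sup>2) powr s) (Gamma (1 + s))"
    using G by (intro has_bochner_integral_nn_integral) auto
  then have "has_bochner_integral (zmcscg 1) (\<lambda>z. v powr s * ((cmod z)\<^sup>2) powr s) (v powr s * Gamma (1 + s))"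
    by (rule has_bochner_integral_mult_right)
  then show ?thesis
    using v by (subst zmcscg_eq_distr_1) (auto intro!: has_bochner_integral_distr simp: power_mult_distrib powr_mult)
qed

lemma AE_zmcscg_nonzero: "AE z in zmcscg v. z \<noteq> 0"
  unfolding zmcscg_def using AE_lborel_singleton[of "0::complex"] by (subst AE_density) auto

lemma zmcscg_cmod_square:
  assumes v: "v > 0"
  shows "has_bochner_integral (zmcscg v) (\<lambda>z. (cmod z)\<^sup>2) v"
  using zmcscg_moment[OF v, of 1] v by (simp add: Gamma_numeral)

section \<open>Logarithmic moments\<close>

text \<open>Supplies a dominating function independent of \<open>h\<close> for differentiating
  moments in the exponent. Convexity of the exponential puts the quotient between
  \<open>ln x\<close> and \<open>x powr h * ln x\<close>; the two summands of the bound serve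
  \<open>x\<close> above and below 1.\<close>

lemma abs_powr_diff_quotient_le:
  fixes x h :: real
  assumes x: "x > 0" and h: "0 < h" "h \<le> 1 / 2"
  shows "\<bar>(x powr h - 1) / h\<bar> \<le> 2 * x + 2 * x powr (-1/2)"
proof -
  define y where "y = h * ln x"
  have xh: "x powr h = exp y"
    using x by (simp add: powr_def y_def)
  have "ln (sqrt x) \<le> sqrt x"
    using x ln_le_minus_one[of "sqrt x"] by simp
  then have l1: "ln x \<le> 2 * x powr (1/2)"
    using x by (simp add: ln_sqrt powr_half_sqrt)
  have "ln (1 / sqrt x) \<le> 1 / sqrt x"
    using x ln_le_minus_one[of "1 / sqrt x"] by simp
  then have l2: "- ln x \<le> 2 * x powr (-1/2)"
    using x by (simp add: ln_sqrt powr_half_sqrt ln_div powr_minus_divide)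
  have lo: "ln x \<le> (x powr h - 1) / h"
    using h exp_ge_add_one_self[of y] by (simp add: xh y_def field_simps)
  have hi: "(x powr h - 1) / h \<le> x powr h * ln x"
  proof -
    have "(1 - y) * exp y \<le> exp (- y) * exp y"
      using exp_ge_add_one_self[of "- y"] by (intro mult_right_mono) auto
    then have "exp y - 1 \<le> exp y * y"
      by (simp add: exp_minus field_simps)
    then show ?thesis
      using h by (simp add: xh y_def field_simps)
  qed
  show ?thesis
  proof (cases "x \<ge> 1")
    case True
    have "x powr h * ln x \<le> x powr (1/2) * (2 * x powr (1/2))"
      using True h l1 by (intro mult_mono powr_mono) auto
    also have "\<dots> = 2 * x"
      using x by (simp add: powr_half_sqrt)
    finally have "(x powr h - 1) / h \<le> 2 * x"
      using hi by simp
    moreover have "0 \<le> (x powr h - 1) / h"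
      using lo True by (intro order_trans[OF _ lo]) simp
    ultimately show ?thesis
      using powr_ge_zero[of x "-1/2"] by linarith
  next
    case False
    then have "x powr h * ln x \<le> 0"
      using x by (intro mult_nonneg_nonpos) auto
    then show ?thesis
      using lo hi l2 x by linarith
  qed
qed

text \<open>Differentiating \<open>E |Z|\<^sup>2\<^sup>h = \<Gamma>(1 + h)\<close> at \<open>h = 0\<close> gives \<open>E ln |Z|\<^sup>2 = \<Gamma>'(1) = - \<gamma>\<close>.\<close>

lemma zmcscg_ln_cmod_square_1:
  "has_bochner_integral (zmcscg 1) (\<lambda>z. ln ((cmod z)\<^sup>2)) (- euler_mascheroni)"
proof -
  interpret prob_space "zmcscg 1" by (rule prob_space_zmcscg) simp
  \<comment> \<open>The shift by 2 keeps \<open>h n\<close> at most 1/2, as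
    \<open>abs_powr_diff_quotient_le\<close> requires.\<close>
  define h where "h = (\<lambda>n::nat. 1 / (real n + 2))"
  have h: "0 < h n" "h n \<le> 1 / 2" for n
    by (auto simp: h_def field_simps)
  have h0: "h \<longlonglongrightarrow> 0"
    unfolding h_def by real_asymp
  have AE0: "AE z in zmcscg 1. z \<noteq> 0"
    by (rule AE_zmcscg_nonzero)
  define q where "q = (\<lambda>n z. (((cmod z)\<^sup>2) powr h n - 1) / h n)"
  let ?w = "\<lambda>z. 2 * (cmod z)\<^sup>2 + 2 * ((cmod z)\<^sup>2) powr (-1/2)"
  have w: "integrable (zmcscg 1) ?w"
    using zmcscg_cmod_square[of 1] zmcscg_moment[of 1 "-1/2"]
    by (intro Bochner_Integration.integrable_add integrable_mult_right) (auto simp: has_bochner_integral_iff)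
  have lim: "AE z in zmcscg 1. (\<lambda>n. q n z) \<longlonglongrightarrow> ln ((cmod z)\<^sup>2)"
    using AE0
  proof eventually_elim
    case (elim z)
    then have x: "(cmod z)\<^sup>2 > 0" by simp
    have "((\<lambda>h. ((cmod z)\<^sup>2) powr h) has_real_derivative ln ((cmod z)\<^sup>2)) (at 0)"
      using x by (auto intro!: derivative_eq_intros)
    then have "((\<lambda>h. (((cmod z)\<^sup>2) powr h - 1) / h) \<longlongrightarrow> ln ((cmod z)\<^sup>2)) (at 0)"
      using x by (simp add: DERIV_def)
    moreover have "filterlim h (at 0) sequentially"
      using h0 h by (auto simp: filterlim_at order_less_imp_not_eq2 intro!: always_eventually)
    ultimately show ?case
      unfolding q_def by (rule filterlim_compose)
  qed
  have bound: "AE z in zmcscg 1. norm (q n z) \<le> ?w z" for n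
    using AE0 by eventually_elim (unfold q_def real_norm_def, intro abs_powr_diff_quotient_le h, simp)
  have meas: "q n \<in> borel_measurable (zmcscg 1)" "(\<lambda>z. ln ((cmod z)\<^sup>2)) \<in> borel_measurable (zmcscg 1)" for n
    unfolding q_def by measurable
  have int: "integrable (zmcscg 1) (\<lambda>z. ln ((cmod z)\<^sup>2))"
    by (rule integrable_dominated_convergence[OF meas(2,1) w lim bound])
  have conv: "(\<lambda>n. \<integral>z. q n z \<partial>zmcscg 1) \<longlonglongrightarrow> (\<integral>z. ln ((cmod z)\<^sup>2) \<partial>zmcscg 1)"
    by (rule integral_dominated_convergence[OF meas(2,1) w lim bound])
  have "(\<integral>z. q n z \<partial>zmcscg 1) = (Gamma (1 + h n) - 1) / h n" for n
  proof -
    have "has_bochner_integral (zmcscg 1) (\<lambda>z. ((cmod z)\<^sup>2) powr h n) (Gamma (1 + h n))"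
      using zmcscg_moment[of 1 "h n"] h(1)[of n] by simp
    then show ?thesis
      unfolding q_def by (auto simp: has_bochner_integral_iff prob_space[simplified])
  qed
  moreover have "(\<lambda>n. (Gamma (1 + h n) - 1) / h n) \<longlonglongrightarrow> - euler_mascheroni"
  proof -
    have "(Gamma has_real_derivative Gamma 1 * Digamma 1) (at 1)"
      by (rule has_field_derivative_Gamma) simp
    then have "((\<lambda>h. (Gamma (1 + h) - 1) / h) \<longlongrightarrow> - euler_mascheroni) (at (0::real))"
      by (simp add: DERIV_def)
    moreover have "filterlim h (at 0) sequentially"
      using h0 h by (auto simp: filterlim_at order_less_imp_not_eq2 intro!: always_eventually)
    ultimately show ?thesis
      by (rule filterlim_compose)
  qed
  ultimately have "(\<integral>z. ln ((cmod z)\<^sup>2) \<partial>zmcscg 1) = - euler_mascheroni"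
    using conv LIMSEQ_unique by simp
  with int show ?thesis
    by (simp add: has_bochner_integral_iff)
qed

lemma zmcscg_ln_cmod:
  assumes v: "v > 0"
  shows "has_bochner_integral (zmcscg v) (\<lambda>z. ln (cmod z)) ((ln v - euler_mascheroni) / 2)"
proof -
  interpret prob_space "zmcscg 1" by (rule prob_space_zmcscg) simp
  have "has_bochner_integral (zmcscg 1) (\<lambda>z. ln v + ln ((cmod z)\<^sup>2)) (ln v + - euler_mascheroni)"
    using zmcscg_ln_cmod_square_1 by (auto simp: has_bochner_integral_iff prob_space[simplified])
  then have "has_bochner_integral (zmcscg 1) (\<lambda>z. (ln v + ln ((cmod z)\<^sup>2)) / 2) ((ln v + - euler_mascheroni) / 2)"
    by (rule has_bochner_integral_divide)
  moreover have "AE z in zmcscg 1. (ln v + ln ((cmod z)\<^sup>2)) / 2 = ln (cmod (sqrt v *\<^sub>R z))"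
    using AE_zmcscg_nonzero by eventually_elim (use v in \<open>auto simp: ln_mult ln_sqrt ln_realpow\<close>)
  ultimately have "has_bochner_integral (zmcscg 1) (\<lambda>z. ln (cmod (sqrt v *\<^sub>R z))) ((ln v + - euler_mascheroni) / 2)"
    by (subst has_bochner_integral_cong_AE[symmetric]) auto
  then show ?thesis
    using v by (subst zmcscg_eq_distr_1) (auto intro!: has_bochner_integral_distr)
qed

text \<open>Rotating by a quarter turn exchanges the components along and across \<open>u\<close>.\<close>

lemma zmcscg_inner_square:
  assumes v: "v > 0" and u: "cmod u = 1"
  shows "has_bochner_integral (zmcscg v) (\<lambda>z. (z \<bullet> u)\<^sup>2) (v / 2)"
proof -
  have sq: "(cmod z)\<^sup>2 = (z \<bullet> u)\<^sup>2 + ((\<i> * z) \<bullet> u)\<^sup>2" for z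
  proof -
    have "(z \<bullet> u)\<^sup>2 + ((\<i> * z) \<bullet> u)\<^sup>2 = (cmod z)\<^sup>2 * (cmod u)\<^sup>2"
      unfolding cmod_power2 by (simp add: inner_complex_def power2_eq_square algebra_simps)
    with u show ?thesis by simp
  qed
  have int0: "integrable (zmcscg v) (\<lambda>z. (cmod z)\<^sup>2)"
    using zmcscg_cmod_square[OF v] by (simp add: has_bochner_integral_iff)
  have int: "integrable (zmcscg v) (\<lambda>z. (z \<bullet> u)\<^sup>2)"
    by (rule Bochner_Integration.integrable_bound[OF int0]) (auto simp: sq)
  have int': "integrable (zmcscg v) (\<lambda>z. ((\<i> * z) \<bullet> u)\<^sup>2)"
    by (rule Bochner_Integration.integrable_bound[OF int0]) (auto simp: sq)
  have "(\<integral>z. (z \<bullet> u)\<^sup>2 \<partial>zmcscg v) = (\<integral>z. (z \<bullet> u)\<^sup>2 \<partial>distr (zmcscg v) borel ((*) \<i>))"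
    by (simp add: distr_zmcscg_rotate)
  also have "\<dots> = (\<integral>z. ((\<i> * z) \<bullet> u)\<^sup>2 \<partial>zmcscg v)"
    by (subst integral_distr) auto
  finally have eq: "(\<integral>z. ((\<i> * z) \<bullet> u)\<^sup>2 \<partial>zmcscg v) = (\<integral>z. (z \<bullet> u)\<^sup>2 \<partial>zmcscg v)" ..
  have "v = (\<integral>z. (cmod z)\<^sup>2 \<partial>zmcscg v)"
    using zmcscg_cmod_square[OF v] by (simp add: has_bochner_integral_iff)
  also have "\<dots> = (\<integral>z. (z \<bullet> u)\<^sup>2 \<partial>zmcscg v) + (\<integral>z. ((\<i> * z) \<bullet> u)\<^sup>2 \<partial>zmcscg v)"
    unfolding sq using int int' by simp
  finally show ?thesis
    using int eq by (simp add: has_bochner_integral_iff)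
qed

subsection \<open>Asymptotics of the Bessel function\<close>

text \<open>A quadratic bound on the whole period provides the Gaussian majorant for Laplace's
  method. It comes from \<open>1 - cos y\<close> being twice the square of the sine of
  \<open>y / 2\<close>, and from \<open>sin z \<ge> z / 3\<close> on [0, 2]; the constant is 2 / 36
  = 1 / 18.\<close>

lemma one_minus_cos_ge:
  fixes y :: real
  assumes "\<bar>y\<bar> \<le> pi"
  shows "y\<^sup>2 / 18 \<le> 1 - cos y"
proof -
  define z where "z = \<bar>y\<bar> / 2"
  have z: "0 \<le> z" "z \<le> 2"
    using assms pi_less_4 by (auto simp: z_def)
  have "(\<Sum>m<3. sin_coeff m * z ^ m) = z"
    by (simp add: numeral_3_eq_3 sin_coeff_def)
  moreover have "inverse (fact 3) * \<bar>z\<bar> ^ 3 = z * z\<^sup>2 / 6"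
    using z by (simp add: fact_numeral power3_eq_cube power2_eq_square)
  ultimately have "\<bar>sin z - z\<bar> \<le> z * z\<^sup>2 / 6"
    using Maclaurin_sin_bound[of z 3] by simp
  moreover have "z * z\<^sup>2 \<le> z * 4"
    using z power_mono[of z 2 2] by (intro mult_left_mono) auto
  ultimately have "z / 3 \<le> sin z"
    by linarith
  then have "(z / 3)\<^sup>2 \<le> (sin z)\<^sup>2"
    using z by (intro power_mono) auto
  moreover have "cos y = 1 - 2 * (sin z)\<^sup>2"
    using cos_double_sin[of z] by (simp add: z_def)
  ultimately show ?thesis
    by (simp add: z_def power_divide)
qed

lemma integral_exp_neg_half_square: "(\<integral>x. exp (- x\<^sup>2 / 2) \<partial>lborel) = sqrt (2 * pi)"
proof -
  have "(\<integral>x. exp (- x\<^sup>2 / 2) \<partial>lborel) = (\<integral>x. sqrt (2 * pi) * std_normal_density x \<partial>lborel)"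
    by (intro Bochner_Integration.integral_cong) (auto simp: std_normal_density_def)
  also have "\<dots> = sqrt (2 * pi)"
    by simp
  finally show ?thesis .
qed

text \<open>The substitution by \<open>x / sqrt t\<close> gives the peak of the integrand at 0 a
  fixed width.\<close>

lemma bessel_I0_rescaled:
  assumes t: "t > 0"
  shows "sqrt t * exp (- t) * (2 * pi * bessel_I0 t)
    = (\<integral>x. exp (- (t * (1 - cos (x / sqrt t)))) * indicator {-pi..pi} (x / sqrt t) \<partial>lborel)"
proof -
  have "2 * pi * bessel_I0 t = (\<integral>x. exp (t * cos x) * indicator {-pi..pi} x \<partial>lborel)"
    by (simp add: bessel_I0_def)
  also have "\<dots> = \<bar>1 / sqrt t\<bar> *\<^sub>R (\<integral>x. exp (t * cos (0 + 1 / sqrt t * x)) * indicator {-pi..pi} (0 + 1 / sqrt t * x) \<partial>lborel)"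
    using t by (intro lborel_integral_real_affine) simp
  finally have "sqrt t * exp (- t) * (2 * pi * bessel_I0 t)
      = exp (- t) * (\<integral>x. exp (t * cos (x / sqrt t)) * indicator {-pi..pi} (x / sqrt t) \<partial>lborel)"
    using t by simp
  also have "\<dots> = (\<integral>x. exp (- (t * (1 - cos (x / sqrt t)))) * indicator {-pi..pi} (x / sqrt t) \<partial>lborel)"
    by (subst integral_mult_right_zero[symmetric])
       (simp add: mult.assoc[symmetric] exp_add[symmetric] algebra_simps)
  finally show ?thesis .
qed

text \<open>Laplace's method: the rescaled integrand tends pointwise to a Gaussian, the indicator
  being eventually 1, and \<open>one_minus_cos_ge\<close> dominates it.\<close>

lemma bessel_I0_asymp: "((\<lambda>t. sqrt t * exp (- t) * (2 * pi * bessel_I0 t)) \<longlongrightarrow> sqrt (2 * pi)) at_top"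
proof -
  let ?s = "\<lambda>t x. exp (- (t * (1 - cos (x / sqrt t)))) * indicator {-pi..pi} (x / sqrt t)"
  have "((\<lambda>t. \<integral>x. ?s t x \<partial>lborel) \<longlongrightarrow> (\<integral>x. exp (- x\<^sup>2 / 2) \<partial>lborel)) at_top"
  proof (rule integral_dominated_convergence_at_top)
    show "integrable lborel (\<lambda>x::real. exp (- x\<^sup>2 / 18))"
    proof -
      have "integrable lborel (\<lambda>x. sqrt (2 * pi * 3\<^sup>2) * normal_density 0 3 x)"
        by (intro integrable_mult_right integrable_normal_density) simp
      then show ?thesis
        by (simp add: normal_density_def)
    qed
    show "AE x in lborel. ((\<lambda>t. ?s t x) \<longlongrightarrow> exp (- x\<^sup>2 / 2)) at_top"
    proof (rule AE_I2)
      fix x :: real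
      have "((\<lambda>t::real. t * (1 - cos (x / sqrt t))) \<longlongrightarrow> x * x / 2) at_top"
        by real_asymp
      then have "((\<lambda>t. exp (- (t * (1 - cos (x / sqrt t))))) \<longlongrightarrow> exp (- (x\<^sup>2 / 2))) at_top"
        unfolding power2_eq_square by (intro tendsto_intros)
      moreover have "eventually (\<lambda>t. exp (- (t * (1 - cos (x / sqrt t)))) = ?s t x) at_top"
      proof -
        have "((\<lambda>t. x / sqrt t) \<longlongrightarrow> 0) at_top"
          by real_asymp
        from tendstoD[OF this pi_gt_zero] have "eventually (\<lambda>t. \<bar>x / sqrt t\<bar> < pi) at_top"
          by (simp only: dist_real_def diff_0_right)
        then show ?thesis
          by eventually_elim (simp only: abs_less_iff indicator_def, simp)
      qed
      ultimately show "((\<lambda>t. ?s t x) \<longlongrightarrow> exp (- x\<^sup>2 / 2)) at_top"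
        by (simp add: tendsto_cong)
    qed
    show "\<forall>\<^sub>F t in at_top. AE x in lborel. norm (?s t x) \<le> exp (- x\<^sup>2 / 18)"
      using eventually_gt_at_top[of 0]
    proof eventually_elim
      case (elim t)
      have "norm (?s t x) \<le> exp (- x\<^sup>2 / 18)" for x
      proof (cases "x / sqrt t \<in> {-pi..pi}")
        case True
        then have "- pi \<le> x / sqrt t" "x / sqrt t \<le> pi"
          by auto
        then have "\<bar>x / sqrt t\<bar> \<le> pi"
          by linarith
        then have "(x / sqrt t)\<^sup>2 / 18 \<le> 1 - cos (x / sqrt t)"
          by (rule one_minus_cos_ge)
        then have "t * ((x / sqrt t)\<^sup>2 / 18) \<le> t * (1 - cos (x / sqrt t))"
          using elim by (intro mult_left_mono) auto
        then have "x\<^sup>2 / 18 \<le> t * (1 - cos (x / sqrt t))"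
          using elim by (simp add: power_divide)
        with True show ?thesis by simp
      qed simp
      then show ?case by simp
    qed
  qed simp_all
  moreover have "eventually (\<lambda>t. (\<integral>x. ?s t x \<partial>lborel) = sqrt t * exp (- t) * (2 * pi * bessel_I0 t)) at_top"
    using eventually_gt_at_top[of 0] by eventually_elim (simp add: bessel_I0_rescaled)
  ultimately show ?thesis
    unfolding integral_exp_neg_half_square by (rule Lim_transform_eventually)
qed

section \<open>The remainder in the logarithmic asymptotics\<close>

text \<open>Crude bounds from the range of the cosine; they give positivity and control small
  arguments, where the asymptotics says nothing.\<close>

lemma bessel_I0_bounds:
  assumes t: "t \<ge> 0"
  shows "exp (- t) \<le> bessel_I0 t" "bessel_I0 t \<le> exp t"
proof -
  have int: "integrable lborel (\<lambda>x. exp (t * cos x) * indicator {-pi..pi} x)"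
  proof -
    have "continuous_on {-pi..pi} (\<lambda>x. exp (t * cos x))"
      by (intro continuous_intros)
    from borel_integrable_atLeastAtMost'[OF this] show ?thesis
      by (simp add: set_integrable_def mult.commute)
  qed
  have intc: "integrable lborel (\<lambda>x. c * indicator {-pi..pi} x)" for c :: real
    by simp
  have le: "- t \<le> t * cos x" "t * cos x \<le> t" for x
    using t mult_left_mono[of "-1" "cos x" t] mult_left_mono[of "cos x" 1 t] by auto
  have "(\<integral>x. exp (- t) * indicator {-pi..pi} x \<partial>lborel) \<le> (\<integral>x. exp (t * cos x) * indicator {-pi..pi} x \<partial>lborel)"
    using le by (intro integral_mono int intc) (auto simp: indicator_def)
  then show "exp (- t) \<le> bessel_I0 t"
    by (simp add: bessel_I0_def field_simps)
  have "(\<integral>x. exp (t * cos x) * indicator {-pi..pi} x \<partial>lborel) \<le> (\<integral>x. exp t * indicator {-pi..pi} x \<partial>lborel)"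
    using le by (intro integral_mono int intc) (auto simp: indicator_def)
  then show "bessel_I0 t \<le> exp t"
    by (simp add: bessel_I0_def field_simps)
qed

definition bessel_err :: "real \<Rightarrow> real" where
  "bessel_err t = ln (bessel_I0 t) - t + ln (2 * pi * t) / 2"

lemma measurable_bessel_err [measurable]: "bessel_err \<in> borel_measurable borel"
  unfolding bessel_err_def by measurable

lemma bessel_err_tendsto: "(bessel_err \<longlongrightarrow> 0) at_top"
proof -
  have "((\<lambda>t. ln (sqrt t * exp (- t) * (2 * pi * bessel_I0 t) / sqrt (2 * pi))) \<longlongrightarrow> ln (sqrt (2 * pi) / sqrt (2 * pi))) at_top"
    by (intro tendsto_ln tendsto_divide bessel_I0_asymp tendsto_const) auto
  moreover have "eventually (\<lambda>t. ln (sqrt t * exp (- t) * (2 * pi * bessel_I0 t) / sqrt (2 * pi)) = bessel_err t) at_top"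
    using eventually_gt_at_top[of 0]
  proof eventually_elim
    case (elim t)
    then have I: "bessel_I0 t > 0"
      using bessel_I0_bounds(1)[of t] exp_gt_zero[of "- t"] by linarith
    have s: "2 * pi / sqrt (2 * pi) = sqrt (2 * pi)"
      by (simp add: real_div_sqrt)
    have "sqrt t * exp (- t) * (2 * pi * bessel_I0 t) / sqrt (2 * pi) = sqrt t * exp (- t) * bessel_I0 t * (2 * pi / sqrt (2 * pi))"
      by simp
    also have "\<dots> = sqrt (2 * pi * t) * exp (- t) * bessel_I0 t"
      unfolding s by (simp add: real_sqrt_mult)
    finally show ?case
      using elim I by (simp add: bessel_err_def ln_mult ln_sqrt)
  qed
  ultimately show ?thesis
    by (simp add: tendsto_cong)
qed

text \<open>For large \<open>t\<close> the remainder is below \<open>e\<close>. Below a threshold it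
  is bounded up to the singularity of \<open>ln t / 2\<close> at 0, and a multiple of
  \<open>t powr (-1/2)\<close>, which stays integrable at the envelopes, dominates both.\<close>

lemma bessel_err_bound:
  assumes e: "e > 0"
  obtains C where "C \<ge> 0" "\<And>t. t > 0 \<Longrightarrow> \<bar>bessel_err t\<bar> \<le> e + C * t powr (-1/2)"
proof -
  have "eventually (\<lambda>t. \<bar>bessel_err t\<bar> < e) at_top"
    using tendstoD[OF bessel_err_tendsto e] by (simp add: dist_real_def)
  then obtain T0 where T0: "\<And>t. t \<ge> T0 \<Longrightarrow> \<bar>bessel_err t\<bar> < e"
    by (auto simp: eventually_at_top_linorder)
  define T where "T = max T0 1"
  have T: "T \<ge> 1" "\<And>t. t \<ge> T \<Longrightarrow> \<bar>bessel_err t\<bar> < e"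
    using T0 by (auto simp: T_def)
  \<comment> \<open>Below \<open>T\<close>, the term \<open>2 * T\<close> bounds the distance of
    \<open>ln (bessel_I0 t)\<close> from \<open>t\<close>, and the logarithm bounds
    \<open>ln (2 * pi * t) / 2\<close> from above.\<close>
  define K where "K = 2 * T + ln (2 * pi * T)"
  have lpi: "ln (2 * pi) \<ge> 0"
    using pi_gt3 by simp
  have K: "K \<ge> 0"
    unfolding K_def using T(1) lpi by (simp add: ln_mult)
  show thesis
  proof
    show "K * sqrt T + 1 \<ge> 0"
      using K T(1) by simp
    fix t :: real assume t: "t > 0"
    show "\<bar>bessel_err t\<bar> \<le> e + (K * sqrt T + 1) * t powr (-1/2)"
    proof (cases "t \<ge> T")
      case True
      moreover have "(K * sqrt T + 1) * t powr (-1/2) \<ge> 0"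
        using K T(1) by simp
      ultimately show ?thesis
        using T(2)[of t] by linarith
    next
      case False
      have tp: "t powr (-1/2) = 1 / sqrt t"
        using t by (simp add: powr_minus_divide powr_half_sqrt)
      have I: "bessel_I0 t > 0"
        using bessel_I0_bounds(1)[of t] exp_gt_zero[of "- t"] t by linarith
      have "ln (1 / sqrt t) \<le> 1 / sqrt t"
        using t ln_le_minus_one[of "1 / sqrt t"] by simp
      then have l: "- (1 / sqrt t) \<le> ln t / 2"
        using t by (simp add: ln_div ln_sqrt)
      have lt: "ln t \<le> ln T"
        using t False T(1) by simp
      have "ln (exp (- t)) \<le> ln (bessel_I0 t)" "ln (bessel_I0 t) \<le> ln (exp t)"
        using bessel_I0_bounds[of t] t I by (simp_all only: ln_le_cancel_iff exp_gt_zero)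
      then have "- t \<le> ln (bessel_I0 t)" "ln (bessel_I0 t) \<le> t"
        by simp_all
      moreover have "ln (2 * pi * t) = ln (2 * pi) + ln t" "ln (2 * pi * T) = ln (2 * pi) + ln T"
        using t T(1) by (simp_all add: ln_mult)
      moreover have "0 \<le> 1 / sqrt t"
        using t by simp
      ultimately have "\<bar>bessel_err t\<bar> \<le> K + 1 / sqrt t"
        unfolding bessel_err_def K_def using t l lt lpi False T(1) ln_ge_zero[OF T(1)] by linarith
      moreover have "K \<le> K * sqrt T * (1 / sqrt t)"
      proof -
        have "1 \<le> sqrt T / sqrt t"
          using t False by simp
        from mult_left_mono[OF this K] show ?thesis by simp
      qed
      ultimately show ?thesis
        using e unfolding tp by (simp add: algebra_simps)
    qed
  qed
qed

subsection \<open>The difference of the envelopes\<close>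

text \<open>Realizes vanishing noise on one fixed space, with the noises multiplied by a shrinking
  factor, so that dominated convergence can be applied.\<close>

lemma chan_space_scale:
  assumes pos: "p > 0" "a > 0" "b > 0" "c > 0"
  shows "chan_space p (c\<^sup>2 * a) (c\<^sup>2 * b)
    = distr (chan_space p a b) (borel \<Otimes>\<^sub>M (borel \<Otimes>\<^sub>M borel)) (\<lambda>(h, w, z). (h, c *\<^sub>R w, c *\<^sub>R z))"
proof -
  let ?f = "(*\<^sub>R) c :: complex \<Rightarrow> complex"
  interpret A: prob_space "zmcscg (c\<^sup>2 * a)" using pos by (intro prob_space_zmcscg) simp
  interpret B: prob_space "zmcscg (c\<^sup>2 * b)" using pos by (intro prob_space_zmcscg) simp
  interpret AB: pair_prob_space "zmcscg (c\<^sup>2 * a)" "zmcscg (c\<^sup>2 * b)" ..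
  have AB: "zmcscg (c\<^sup>2 * a) \<Otimes>\<^sub>M zmcscg (c\<^sup>2 * b)
      = distr (zmcscg a \<Otimes>\<^sub>M zmcscg b) (borel \<Otimes>\<^sub>M borel) (\<lambda>(w, z). (?f w, ?f z))"
    using pos B.sigma_finite_measure_axioms
    by (simp only: zmcscg_scale[symmetric]) (rule pair_measure_distr; simp)
  have "chan_space p (c\<^sup>2 * a) (c\<^sup>2 * b) = distr (zmcscg p) borel (\<lambda>h. h) \<Otimes>\<^sub>M
      distr (zmcscg a \<Otimes>\<^sub>M zmcscg b) (borel \<Otimes>\<^sub>M borel) (\<lambda>(w, z). (?f w, ?f z))"
    unfolding chan_space_def AB by (simp add: distr_id2)
  also have "\<dots> = distr (zmcscg p \<Otimes>\<^sub>M (zmcscg a \<Otimes>\<^sub>M zmcscg b)) (borel \<Otimes>\<^sub>M (borel \<Otimes>\<^sub>M borel))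
      (\<lambda>(h, wz). (h, (\<lambda>(w, z). (?f w, ?f z)) wz))"
    using AB.sigma_finite_measure_axioms unfolding AB by (intro pair_measure_distr) simp_all
  also have "\<dots> = distr (chan_space p a b) (borel \<Otimes>\<^sub>M (borel \<Otimes>\<^sub>M borel)) (\<lambda>(h, w, z). (h, c *\<^sub>R w, c *\<^sub>R z))"
    unfolding chan_space_def by (intro distr_cong) auto
  finally show ?thesis .
qed

lemma integrable_chan_noise_square:
  assumes pos: "p > 0" "a > 0" "b > 0"
  shows "integrable (chan_space p a b) (\<lambda>w. (cmod (fst (snd w)))\<^sup>2)"
    and "integrable (chan_space p a b) (\<lambda>w. (cmod (snd (snd w)))\<^sup>2)"
proof -
  interpret P: prob_space "zmcscg p" using pos by (intro prob_space_zmcscg)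
  interpret A: prob_space "zmcscg a" using pos by (intro prob_space_zmcscg)
  interpret B: prob_space "zmcscg b" using pos by (intro prob_space_zmcscg)
  have N: "(\<integral>\<^sup>+z. ennreal ((cmod z)\<^sup>2) \<partial>zmcscg v) = ennreal v" if "v > 0" for v
    using zmcscg_cmod_square[OF that] that
    by (subst nn_integral_eq_integral) (auto simp: has_bochner_integral_iff)
  show "integrable (chan_space p a b) (\<lambda>w. (cmod (fst (snd w)))\<^sup>2)"
  proof (rule integrableI_nn_integral_finite)
    show "(\<integral>\<^sup>+w. ennreal ((cmod (fst (snd w)))\<^sup>2) \<partial>chan_space p a b) = ennreal a"
      using pos by (subst nn_integral_chan_space)
        (simp_all add: N P.emeasure_space_1[simplified] B.emeasure_space_1[simplified])
  qed simp_all
  show "integrable (chan_space p a b) (\<lambda>w. (cmod (snd (snd w)))\<^sup>2)"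
  proof (rule integrableI_nn_integral_finite)
    show "(\<integral>\<^sup>+w. ennreal ((cmod (snd (snd w)))\<^sup>2) \<partial>chan_space p a b) = ennreal b"
      using pos by (subst nn_integral_chan_space)
        (simp_all add: N P.emeasure_space_1[simplified] A.emeasure_space_1[simplified])
  qed simp_all
qed

text \<open>For fixed nonzero \<open>h\<close>, a half turn of the second noise makes the difference
  a sum, Gaussian of variance \<open>a + b\<close>; its component along a unit vector carries half
  of that.\<close>

lemma integral_chan_radial_noise_square:
  assumes pos: "p > 0" "a > 0" "b > 0"
  shows "(\<integral>w. ((fst (snd w) - snd (snd w)) \<bullet> sgn (fst w))\<^sup>2 \<partial>chan_space p a b) = (a + b) / 2"
proof -
  interpret P: prob_space "zmcscg p" using pos by (intro prob_space_zmcscg)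
  have inner: "(\<integral>\<^sup>+w. \<integral>\<^sup>+z. ennreal (((w - z) \<bullet> sgn h)\<^sup>2) \<partial>zmcscg b \<partial>zmcscg a) = ennreal ((a + b) / 2)"
    if "h \<noteq> 0" for h
  proof -
    have "(\<integral>\<^sup>+w. \<integral>\<^sup>+z. ennreal (((w - z) \<bullet> sgn h)\<^sup>2) \<partial>zmcscg b \<partial>zmcscg a)
        = (\<integral>\<^sup>+w. \<integral>\<^sup>+z. ennreal (((w + z) \<bullet> sgn h)\<^sup>2) \<partial>zmcscg b \<partial>zmcscg a)"
    proof (rule nn_integral_cong)
      fix w
      show "(\<integral>\<^sup>+z. ennreal (((w - z) \<bullet> sgn h)\<^sup>2) \<partial>zmcscg b) = (\<integral>\<^sup>+z. ennreal (((w + z) \<bullet> sgn h)\<^sup>2) \<partial>zmcscg b)"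
        using nn_integral_zmcscg_rotate[of "\<lambda>z. ennreal (((w - z) \<bullet> sgn h)\<^sup>2)" "-1" b]
        by (simp del: inner_diff_left inner_add_left)
    qed
    also have "\<dots> = (\<integral>\<^sup>+u. ennreal ((u \<bullet> sgn h)\<^sup>2) \<partial>zmcscg (a + b))"
      using pos by (intro nn_integral_zmcscg_add) simp_all
    also have "\<dots> = ennreal ((a + b) / 2)"
      using zmcscg_inner_square[of "a + b" "sgn h"] pos that
      by (subst nn_integral_eq_integral) (auto simp: has_bochner_integral_iff norm_sgn)
    finally show ?thesis .
  qed
  have "(\<integral>\<^sup>+w. ennreal (((fst (snd w) - snd (snd w)) \<bullet> sgn (fst w))\<^sup>2) \<partial>chan_space p a b)
      = (\<integral>\<^sup>+h. \<integral>\<^sup>+w. \<integral>\<^sup>+z. ennreal (((w - z) \<bullet> sgn h)\<^sup>2) \<partial>zmcscg b \<partial>zmcscg a \<partial>zmcscg p)"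
    using pos by (subst nn_integral_chan_space) simp_all
  also have "\<dots> = (\<integral>\<^sup>+h. ennreal ((a + b) / 2) \<partial>zmcscg p)"
  proof (rule nn_integral_cong_AE)
    \<comment> \<open>At \<open>h = 0\<close> the direction \<open>sgn h\<close> is 0 and the
      formula fails, but this is a null set.\<close>
    show "AE h in zmcscg p. (\<integral>\<^sup>+w. \<integral>\<^sup>+z. ennreal (((w - z) \<bullet> sgn h)\<^sup>2) \<partial>zmcscg b \<partial>zmcscg a) = ennreal ((a + b) / 2)"
      using AE_zmcscg_nonzero by eventually_elim (rule inner)
  qed
  also have "\<dots> = ennreal ((a + b) / 2)"
    by (simp add: P.emeasure_space_1[simplified])
  finally show ?thesis
    using pos by (subst integral_eq_nn_integral) auto
qed

text \<open>Away from 0 the norm is differentiable with gradient \<open>sgn h\<close>; the limit is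
  a difference of two directional derivatives.\<close>

lemma norm_diff_quotient_tendsto:
  fixes h w z :: "'a::real_inner"
  assumes "h \<noteq> 0"
  shows "((\<lambda>\<epsilon>. (norm (h + \<epsilon> *\<^sub>R w) - norm (h + \<epsilon> *\<^sub>R z)) / \<epsilon>) \<longlongrightarrow> (w - z) \<bullet> sgn h) (at 0)"
proof -
  have d: "((\<lambda>\<epsilon>. norm (h + \<epsilon> *\<^sub>R x)) has_real_derivative x \<bullet> sgn h) (at 0)" for x :: 'a
  proof -
    have "((\<lambda>\<epsilon>. h + \<epsilon> *\<^sub>R x) has_derivative (\<lambda>\<epsilon>. \<epsilon> *\<^sub>R x)) (at 0)"
      by (auto intro!: derivative_eq_intros)
    moreover have "(norm has_derivative (\<lambda>y. y \<bullet> sgn h)) (at (h + 0 *\<^sub>R x))"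
      using has_derivative_norm[OF assms] by simp
    ultimately have "((\<lambda>\<epsilon>. norm (h + \<epsilon> *\<^sub>R x)) has_derivative (\<lambda>\<epsilon>. (\<epsilon> *\<^sub>R x) \<bullet> sgn h)) (at 0)"
      by (rule has_derivative_compose)
    then show ?thesis
      by (simp add: has_field_derivative_def mult_commute_abs)
  qed
  show ?thesis
    using DERIV_diff[OF d[of w] d[of z]] by (simp add: DERIV_def inner_diff_left)
qed

text \<open>With noise variances fixed at 1 and \<open>a\<close> and the noises multiplied by the
  root of \<open>s\<close>, the scaled difference converges almost surely to the radial component of
  the noise difference. The triangle inequality gives a majorant free of \<open>s\<close>.\<close>

lemma env_diff_square_tendsto:
  assumes pos: "p > 0" "a > 0"
  shows "((\<lambda>s. (\<integral>w. (env_A w - env_B w)\<^sup>2 \<partial>chan_space p s (a * s)) / s) \<longlongrightarrow> (1 + a) / 2) (at_right 0)"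
  \<comment> \<open>Dominated convergence is applied along an arbitrary sequence of positive
    variances tending to 0.\<close>
  unfolding tendsto_at_iff_sequentially comp_def
proof (intro allI impI)
  fix X :: "nat \<Rightarrow> real"
  assume "\<forall>i. X i \<in> {0<..} - {0}" and X0: "X \<longlonglongrightarrow> 0"
  then have X: "X n > 0" for n by auto
  let ?M = "chan_space p 1 a"
  define q where "q = (\<lambda>n w. ((cmod (fst w + sqrt (X n) *\<^sub>R fst (snd w)) - cmod (fst w + sqrt (X n) *\<^sub>R snd (snd w))) / sqrt (X n))\<^sup>2)"
  let ?l = "\<lambda>w::complex \<times> complex \<times> complex. ((fst (snd w) - snd (snd w)) \<bullet> sgn (fst w))\<^sup>2"
  let ?b = "\<lambda>w::complex \<times> complex \<times> complex. 2 * (cmod (fst (snd w)))\<^sup>2 + 2 * (cmod (snd (snd w)))\<^sup>2"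
  have b: "integrable ?M ?b"
    using integrable_chan_noise_square[of p 1 a] pos
    by (intro Bochner_Integration.integrable_add integrable_mult_right) auto
  have bound: "norm (q n w) \<le> ?b w" for n w
  proof -
    let ?e = "sqrt (X n)" and ?w = "fst (snd w)" and ?z = "snd (snd w)"
    have e: "?e > 0" using X by simp
    have "\<bar>cmod (fst w + ?e *\<^sub>R ?w) - cmod (fst w + ?e *\<^sub>R ?z)\<bar> \<le> cmod (?e *\<^sub>R (?w - ?z))"
      using norm_triangle_ineq3[of "fst w + ?e *\<^sub>R ?w" "fst w + ?e *\<^sub>R ?z"] by (simp add: algebra_simps)
    also have "\<dots> \<le> ?e * (cmod ?w + cmod ?z)"
      using e norm_triangle_ineq4[of ?w ?z] by simp
    finally have "\<bar>(cmod (fst w + ?e *\<^sub>R ?w) - cmod (fst w + ?e *\<^sub>R ?z)) / ?e\<bar> \<le> cmod ?w + cmod ?z"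
      using e by (simp only: abs_divide abs_of_pos pos_divide_le_eq mult.commute[of _ ?e])
    then have "q n w \<le> (cmod ?w + cmod ?z)\<^sup>2"
      unfolding q_def by (rule power2_le_iff_abs_le[THEN iffD2, rotated]) simp
    also have "\<dots> \<le> ?b w"
      using sum_squares_bound[of "cmod ?w" "cmod ?z"] by (simp add: power2_sum)
    finally show ?thesis
      by (simp add: q_def)
  qed
  have lim: "AE w in ?M. (\<lambda>n. q n w) \<longlonglongrightarrow> ?l w"
  proof -
    interpret A: prob_space "zmcscg 1" by (intro prob_space_zmcscg) simp
    interpret B: prob_space "zmcscg a" using pos by (intro prob_space_zmcscg)
    interpret P: prob_space "zmcscg p" using pos by (intro prob_space_zmcscg)
    interpret AB: pair_prob_space "zmcscg 1" "zmcscg a" ..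
    interpret PAB: pair_prob_space "zmcscg p" "zmcscg 1 \<Otimes>\<^sub>M zmcscg a" ..
    have "AE w in ?M. fst w \<noteq> 0"
      unfolding chan_space_def
    proof (rule PAB.AE_pair_measure)
      show "AE x in zmcscg p. AE y in zmcscg 1 \<Otimes>\<^sub>M zmcscg a. fst (x, y) \<noteq> 0"
        using AE_zmcscg_nonzero by eventually_elim simp
    qed measurable
    then show ?thesis
    proof eventually_elim
      case (elim w)
      have "filterlim (\<lambda>n. sqrt (X n)) (at 0) sequentially"
        using tendsto_real_sqrt[OF X0] X by (auto simp: filterlim_at order_less_imp_not_eq2 intro!: always_eventually)
      from filterlim_compose[OF norm_diff_quotient_tendsto[OF elim] this] show ?case
        unfolding q_def by (rule tendsto_power)
    qed
  qed
  have "(\<lambda>n. \<integral>w. q n w \<partial>?M) \<longlonglongrightarrow> (\<integral>w. ?l w \<partial>?M)"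
  proof (rule integral_dominated_convergence[OF _ _ b lim])
    show "AE w in ?M. norm (q n w) \<le> ?b w" for n
      using bound by (intro AE_I2)
    show "q n \<in> borel_measurable ?M" for n
      unfolding q_def by measurable
    show "?l \<in> borel_measurable ?M"
      unfolding sgn_div_norm by measurable
  qed
  moreover have "(\<integral>w. ?l w \<partial>?M) = (1 + a) / 2"
    using pos by (intro integral_chan_radial_noise_square) auto
  moreover have "(\<integral>w. q n w \<partial>?M) = (\<integral>w. (env_A w - env_B w)\<^sup>2 \<partial>chan_space p (X n) (a * X n)) / X n" for n
  proof -
    have "chan_space p (X n) (a * X n) = distr ?M (borel \<Otimes>\<^sub>M (borel \<Otimes>\<^sub>M borel)) (\<lambda>(h, w, z). (h, sqrt (X n) *\<^sub>R w, sqrt (X n) *\<^sub>R z))"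
      using chan_space_scale[of p 1 a "sqrt (X n)"] pos X[of n]
      by (simp only: real_sqrt_gt_0_iff zero_less_one real_sqrt_pow2 less_imp_le mult.commute[of _ a] mult_1_right)
    then have "(\<integral>w. (env_A w - env_B w)\<^sup>2 \<partial>chan_space p (X n) (a * X n))
       = (\<integral>w. (cmod (fst w + sqrt (X n) *\<^sub>R fst (snd w)) - cmod (fst w + sqrt (X n) *\<^sub>R snd (snd w)))\<^sup>2 \<partial>?M)"
      by (simp only:) (subst integral_distr; simp add: env_A_def env_B_def case_prod_beta)
    moreover have "q n w = (cmod (fst w + sqrt (X n) *\<^sub>R fst (snd w)) - cmod (fst w + sqrt (X n) *\<^sub>R snd (snd w)))\<^sup>2 / X n" for w
      using X[of n] by (simp add: q_def power_divide)
    ultimately show ?thesis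
      by (simp only: integral_divide_zero)
  qed
  ultimately show "(\<lambda>n. (\<integral>w. (env_A w - env_B w)\<^sup>2 \<partial>chan_space p (X n) (a * X n)) / X n) \<longlonglongrightarrow> (1 + a) / 2"
    by (simp only:)
qed

subsection \<open>Expansion of the mutual information\<close>

lemma has_bochner_integral_env:
  fixes F :: "real \<Rightarrow> real"
  assumes pos: "p > 0" "a > 0" "b > 0" and [measurable]: "F \<in> borel_measurable borel"
  shows "has_bochner_integral (zmcscg (p + a)) (\<lambda>z. F (cmod z)) x \<Longrightarrow>
      has_bochner_integral (chan_space p a b) (\<lambda>w. F (env_A w)) x"
    and "has_bochner_integral (zmcscg (p + b)) (\<lambda>z. F (cmod z)) x \<Longrightarrow>
      has_bochner_integral (chan_space p a b) (\<lambda>w. F (env_B w)) x"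
proof -
  assume "has_bochner_integral (zmcscg (p + a)) (\<lambda>z. F (cmod z)) x"
  then have "has_bochner_integral (distr (chan_space p a b) borel env_A) F x"
    unfolding distr_env[OF pos] by (intro has_bochner_integral_distr) auto
  then show "has_bochner_integral (chan_space p a b) (\<lambda>w. F (env_A w)) x"
    by (simp add: has_bochner_integral_iff integral_distr integrable_distr_eq)
next
  assume "has_bochner_integral (zmcscg (p + b)) (\<lambda>z. F (cmod z)) x"
  then have "has_bochner_integral (distr (chan_space p a b) borel env_B) F x"
    unfolding distr_env[OF pos] by (intro has_bochner_integral_distr) auto
  then show "has_bochner_integral (chan_space p a b) (\<lambda>w. F (env_B w)) x"
    by (simp add: has_bochner_integral_iff integral_distr integrable_distr_eq)
qed

text \<open>Positivity off a null set allows the logarithms of products to be split.\<close>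

lemma AE_env_pos:
  assumes pos: "p > 0" "a > 0" "b > 0"
  shows "AE w in chan_space p a b. env_A w > 0 \<and> env_B w > 0"
proof -
  have *: "AE x in distr (zmcscg v) borel cmod. x > 0" for v
    by (subst AE_distr_iff) (auto intro: AE_mp[OF AE_zmcscg_nonzero AE_I2])
  have "AE w in chan_space p a b. env_A w > 0"
    using *[of "p + a"] unfolding distr_env(1)[OF pos, symmetric] by (subst (asm) AE_distr_iff) auto
  moreover have "AE w in chan_space p a b. env_B w > 0"
    using *[of "p + b"] unfolding distr_env(2)[OF pos, symmetric] by (subst (asm) AE_distr_iff) auto
  ultimately show ?thesis by eventually_elim simp
qed

lemma env_moments:
  assumes pos: "p > 0" "a > 0" "b > 0"
  shows env_A_square: "has_bochner_integral (chan_space p a b) (\<lambda>w. (env_A w)\<^sup>2) (p + a)"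
    and env_B_square: "has_bochner_integral (chan_space p a b) (\<lambda>w. (env_B w)\<^sup>2) (p + b)"
    and env_A_ln: "has_bochner_integral (chan_space p a b) (\<lambda>w. ln (env_A w)) ((ln (p + a) - euler_mascheroni) / 2)"
    and env_B_ln: "has_bochner_integral (chan_space p a b) (\<lambda>w. ln (env_B w)) ((ln (p + b) - euler_mascheroni) / 2)"
    and env_A_inverse: "has_bochner_integral (chan_space p a b) (\<lambda>w. ((env_A w)\<^sup>2) powr (-1/2)) ((p + a) powr (-1/2) * Gamma (1/2))"
    and env_B_inverse: "has_bochner_integral (chan_space p a b) (\<lambda>w. ((env_B w)\<^sup>2) powr (-1/2)) ((p + b) powr (-1/2) * Gamma (1/2))"
  using pos zmcscg_cmod_square[of "p + a"] zmcscg_cmod_square[of "p + b"]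
    zmcscg_ln_cmod[of "p + a"] zmcscg_ln_cmod[of "p + b"]
    zmcscg_moment[of "p + a" "-1/2"] zmcscg_moment[of "p + b" "-1/2"]
  by (auto intro!: has_bochner_integral_env[where F = "\<lambda>x. x\<^sup>2"] has_bochner_integral_env[where F = ln]
      has_bochner_integral_env[where F = "\<lambda>x. (x\<^sup>2) powr - (1/2)"])

text \<open>Polarization: the mean product follows from the known second moments and the mean
  squared difference.\<close>

lemma integral_env_mult:
  assumes pos: "p > 0" "a > 0" "b > 0"
  shows "has_bochner_integral (chan_space p a b) (\<lambda>w. env_A w * env_B w)
    ((2 * p + a + b - (\<integral>w. (env_A w - env_B w)\<^sup>2 \<partial>chan_space p a b)) / 2)"
proof -
  note A = env_A_square[OF pos] and B = env_B_square[OF pos]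
  have iA: "integrable (chan_space p a b) (\<lambda>w. (env_A w)\<^sup>2)" and iB: "integrable (chan_space p a b) (\<lambda>w. (env_B w)\<^sup>2)"
    using A B by (auto simp: has_bochner_integral_iff)
  have int: "integrable (chan_space p a b) (\<lambda>w. env_A w * env_B w)"
  proof (rule Bochner_Integration.integrable_bound[OF Bochner_Integration.integrable_add[OF iA iB]])
    have "\<bar>x * y\<bar> \<le> x\<^sup>2 + y\<^sup>2" for x y :: real
    proof -
      have "2 * (\<bar>x\<bar> * \<bar>y\<bar>) \<le> x\<^sup>2 + y\<^sup>2" "0 \<le> \<bar>x\<bar> * \<bar>y\<bar>"
        using sum_squares_bound[of "\<bar>x\<bar>" "\<bar>y\<bar>"] by (simp_all add: mult.assoc)
      then show ?thesis
        unfolding abs_mult by linarith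
    qed
    then show "AE w in chan_space p a b. norm (env_A w * env_B w) \<le> norm ((env_A w)\<^sup>2 + (env_B w)\<^sup>2)"
      by simp
  qed simp
  have "(\<integral>w. (env_A w - env_B w)\<^sup>2 \<partial>chan_space p a b)
      = (\<integral>w. (env_A w)\<^sup>2 + (env_B w)\<^sup>2 - 2 * (env_A w * env_B w) \<partial>chan_space p a b)"
    by (simp add: power2_diff mult.assoc)
  also have "\<dots> = (p + a) + (p + b) - 2 * (\<integral>w. env_A w * env_B w \<partial>chan_space p a b)"
    using iA iB int A B by (simp add: has_bochner_integral_iff)
  finally show ?thesis
    using int by (simp add: has_bochner_integral_iff)
qed

section \<open>Bounds on the expected remainder\<close>

text \<open>The inverse root of a product is at most the inverse of the smaller factor, hence at
  most the sum of both inverses. The resulting bound depends on the noise only through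
  \<open>c\<close>.\<close>

lemma env_inverse_sqrt_bound:
  assumes pos: "p > 0" "a > 0" "b > 0" and c: "c > 0"
  shows "integrable (chan_space p a b) (\<lambda>w. (c * (env_A w * env_B w)) powr (-1/2))"
    and "(\<integral>w. (c * (env_A w * env_B w)) powr (-1/2) \<partial>chan_space p a b) \<le> c powr (-1/2) * (2 * p powr (-1/2) * Gamma (1/2))"
proof -
  note A = env_A_inverse[OF pos] and B = env_B_inverse[OF pos]
  let ?b = "\<lambda>w. c powr (-1/2) * (((env_A w)\<^sup>2) powr (-1/2) + ((env_B w)\<^sup>2) powr (-1/2))"
  have b: "integrable (chan_space p a b) ?b"
    using A B by (auto simp: has_bochner_integral_iff)
  have le: "(c * (env_A w * env_B w)) powr (-1/2) \<le> ?b w" for w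
  proof -
    have *: "(x * y) powr (-1/2) \<le> (x\<^sup>2) powr (-1/2) + (y\<^sup>2) powr (-1/2)" if "x \<ge> 0" "y \<ge> 0" for x y :: real
    proof (cases "x = 0 \<or> y = 0")
      case False
      with that have xy: "x > 0" "y > 0" by auto
      define m where "m = min x y"
      have m: "m > 0" "m\<^sup>2 \<le> x * y"
        using xy by (auto simp: m_def power2_eq_square intro!: mult_mono)
      have "(x * y) powr (-1/2) \<le> (m\<^sup>2) powr (-1/2)"
        using m by (intro powr_mono2') auto
      also have "\<dots> \<le> (x\<^sup>2) powr (-1/2) + (y\<^sup>2) powr (-1/2)"
        by (simp add: m_def min_def)
      finally show ?thesis .
    \<comment> \<open>If a factor is 0, the left side is \<open>0 powr (-1/2) = 0\<close>.\<close>
    qed auto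
    have "env_A w \<ge> 0" "env_B w \<ge> 0" by (auto simp: env_A_def env_B_def)
    then show ?thesis
      using c *[of "env_A w" "env_B w"] by (simp add: powr_mult mult_left_mono)
  qed
  show int: "integrable (chan_space p a b) (\<lambda>w. (c * (env_A w * env_B w)) powr (-1/2))"
    using le by (intro Bochner_Integration.integrable_bound[OF b] AE_I2) (auto simp: abs_of_nonneg)
  have mono: "(p + x) powr (-1/2) \<le> p powr (-1/2)" if "x > 0" for x
    using pos that by (intro powr_mono2') auto
  have G: "Gamma (1/2 :: real) > 0" by (intro Gamma_real_pos) simp
  have "(\<integral>w. (c * (env_A w * env_B w)) powr (-1/2) \<partial>chan_space p a b) \<le> (\<integral>w. ?b w \<partial>chan_space p a b)"
    using le by (intro integral_mono int b)
  also have "\<dots> = c powr (-1/2) * ((p + a) powr (-1/2) * Gamma (1/2) + (p + b) powr (-1/2) * Gamma (1/2))"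
    using A B by (simp add: has_bochner_integral_iff)
  also have "\<dots> = c powr (-1/2) * (((p + a) powr (-1/2) + (p + b) powr (-1/2)) * Gamma (1/2))"
    by (simp add: algebra_simps)
  also have "\<dots> \<le> c powr (-1/2) * (2 * p powr (-1/2) * Gamma (1/2))"
    using mono[OF pos(2)] mono[OF pos(3)] G by (intro mult_left_mono mult_right_mono) auto
  finally show "(\<integral>w. (c * (env_A w * env_B w)) powr (-1/2) \<partial>chan_space p a b) \<le> c powr (-1/2) * (2 * p powr (-1/2) * Gamma (1/2))" .
qed

lemma env_bessel_err_bound:
  assumes pos: "p > 0" "a > 0" "b > 0" and c: "c > 0" and C: "C \<ge> 0"
    and err: "\<And>t. t > 0 \<Longrightarrow> \<bar>bessel_err t\<bar> \<le> e + C * t powr (-1/2)"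
  shows "integrable (chan_space p a b) (\<lambda>w. bessel_err (c * (env_A w * env_B w)))"
    and "\<bar>\<integral>w. bessel_err (c * (env_A w * env_B w)) \<partial>chan_space p a b\<bar>
      \<le> e + C * (c powr (-1/2) * (2 * p powr (-1/2) * Gamma (1/2)))"
proof -
  interpret prob_space "chan_space p a b" using pos by (rule prob_space_chan_space)
  let ?T = "\<lambda>w. c * (env_A w * env_B w)"
  have b: "integrable (chan_space p a b) (\<lambda>w. e + C * ?T w powr (-1/2))"
    using env_inverse_sqrt_bound(1)[OF pos c] by simp
  have le: "AE w in chan_space p a b. \<bar>bessel_err (?T w)\<bar> \<le> e + C * ?T w powr (-1/2)"
    using AE_env_pos[OF pos] by eventually_elim (rule err, use c in simp)
  show int: "integrable (chan_space p a b) (\<lambda>w. bessel_err (?T w))"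
    by (rule Bochner_Integration.integrable_bound[OF b]) (use le in \<open>auto elim!: eventually_mono\<close>)
  have "\<bar>\<integral>w. bessel_err (?T w) \<partial>chan_space p a b\<bar> \<le> (\<integral>w. \<bar>bessel_err (?T w)\<bar> \<partial>chan_space p a b)"
    by (rule integral_abs_bound)
  also have "\<dots> \<le> (\<integral>w. e + C * ?T w powr (-1/2) \<partial>chan_space p a b)"
    using int le b by (intro integral_mono_AE) auto
  also have "\<dots> = e + C * (\<integral>w. ?T w powr (-1/2) \<partial>chan_space p a b)"
    using env_inverse_sqrt_bound(1)[OF pos c] by (simp add: prob_space)
  also have "\<dots> \<le> e + C * (c powr (-1/2) * (2 * p powr (-1/2) * Gamma (1/2)))"
    using env_inverse_sqrt_bound(2)[OF pos c] C by (intro add_left_mono mult_left_mono)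
  finally show "\<bar>\<integral>w. bessel_err (?T w) \<partial>chan_space p a b\<bar>
      \<le> e + C * (c powr (-1/2) * (2 * p powr (-1/2) * Gamma (1/2)))" .
qed

text \<open>The logarithm of \<open>env_ratio\<close> is expanded with \<open>bessel_err\<close> as
  exact remainder and integrated term by term. The quadratic form contributes
  \<open>2 * p\<^sup>2 / D\<close> because each normalized square has mean one.\<close>

lemma env_MI_expansion:
  assumes pos: "p > 0" "a > 0" "b > 0"
  defines "D \<equiv> cov_det p a b"
  defines "c \<equiv> 2 * p / D"
  shows "ln 2 * env_MI p a b = ln ((p + a) * (p + b) / D) - 2 * p\<^sup>2 / D
      + c * ((2 * p + a + b - (\<integral>w. (env_A w - env_B w)\<^sup>2 \<partial>chan_space p a b)) / 2)
      - ln (2 * pi * c) / 2 - ((ln (p + a) - euler_mascheroni) / 2 + (ln (p + b) - euler_mascheroni) / 2) / 2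
      + (\<integral>w. bessel_err (c * (env_A w * env_B w)) \<partial>chan_space p a b)"
proof -
  interpret prob_space "chan_space p a b" using pos by (rule prob_space_chan_space)
  have D: "D > 0" unfolding D_def using pos by (rule cov_det_pos)
  have c: "c > 0" unfolding c_def using D pos by simp
  let ?K = "(p + a) * (p + b) / D"
  \<comment> \<open>The tolerance 1 is arbitrary: only integrability of the remainder matters
    here.\<close>
  obtain C where C: "C \<ge> 0" "\<And>t. t > 0 \<Longrightarrow> \<bar>bessel_err t\<bar> \<le> 1 + C * t powr (-1/2)"
    using bessel_err_bound[of 1] by auto
  note int_err = env_bessel_err_bound(1)[OF pos c C]
  let ?g = "\<lambda>w. ln ?K - p\<^sup>2 / D * ((env_A w)\<^sup>2 / (p + a) + (env_B w)\<^sup>2 / (p + b)) + c * (env_A w * env_B w)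
     - ln (2 * pi * c) / 2 - (ln (env_A w) + ln (env_B w)) / 2 + bessel_err (c * (env_A w * env_B w))"
  have "ln 2 * env_MI p a b = (\<integral>w. ln (env_ratio p a b (env_A w) (env_B w)) \<partial>chan_space p a b)"
    unfolding env_MI_eq[OF pos] by (simp add: log_def)
  also have "\<dots> = (\<integral>w. ?g w \<partial>chan_space p a b)"
  proof (rule integral_cong_AE)
    show "AE w in chan_space p a b. ln (env_ratio p a b (env_A w) (env_B w)) = ?g w"
      using AE_env_pos[OF pos]
    proof eventually_elim
      case (elim w)
      define x y where "x = env_A w" and "y = env_B w"
      have xy: "x > 0" "y > 0" using elim by (auto simp: x_def y_def)
      define t where "t = c * (x * y)"
      have t: "t > 0" using xy c by (simp add: t_def)
      have I: "bessel_I0 t > 0"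
        using bessel_I0_bounds(1)[of t] exp_gt_zero[of "- t"] t by linarith
      have K: "?K > 0" using pos D by simp
      have ln_exp: "ln (k * exp (- r) * i) = ln k - r + ln i" if "k > 0" "i > 0" for k r i :: real
        using that by (simp add: ln_mult_pos)
      have "ln (env_ratio p a b x y) = ln ?K - p\<^sup>2 / D * (x\<^sup>2 / (p + a) + y\<^sup>2 / (p + b)) + ln (bessel_I0 t)"
        unfolding env_ratio_def env_weight_def D_def[symmetric] c_def[symmetric] t_def[symmetric]
        by (rule ln_exp[OF K I])
      moreover have "ln (2 * pi * t) = ln (2 * pi * c) + (ln x + ln y)"
      proof -
        have "2 * pi * t = 2 * pi * c * (x * y)" by (simp add: t_def)
        then show ?thesis using xy c by (simp only: ln_mult_pos mult_pos_pos pi_gt_zero zero_less_numeral)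
      qed
      \<comment> \<open>Adds and subtracts the leading asymptotics, with \<open>i\<close> for the
        logarithm of the Bessel function; the last bracket is \<open>bessel_err t\<close>.\<close>
      moreover have "k - q + i = k - q + t - l / 2 - m / 2 + (i - t + (l + m) / 2)" for k q i l m :: real
        by (simp add: field_simps)
      ultimately show ?case
        unfolding bessel_err_def x_def[symmetric] y_def[symmetric] t_def[symmetric] by (simp only:)
    qed
  qed simp_all
  also have "\<dots> = ln ?K - p\<^sup>2 / D * ((p + a) / (p + a) + (p + b) / (p + b))
      + c * ((2 * p + a + b - (\<integral>w. (env_A w - env_B w)\<^sup>2 \<partial>chan_space p a b)) / 2)
      - ln (2 * pi * c) / 2 - ((ln (p + a) - euler_mascheroni) / 2 + (ln (p + b) - euler_mascheroni) / 2) / 2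
      + (\<integral>w. bessel_err (c * (env_A w * env_B w)) \<partial>chan_space p a b)"
  proof (rule has_bochner_integral_integral_eq)
    have const: "has_bochner_integral (chan_space p a b) (\<lambda>w. k) k" for k :: real
      by (simp add: has_bochner_integral_iff prob_space)
    show "has_bochner_integral (chan_space p a b) ?g (ln ?K - p\<^sup>2 / D * ((p + a) / (p + a) + (p + b) / (p + b))
      + c * ((2 * p + a + b - (\<integral>w. (env_A w - env_B w)\<^sup>2 \<partial>chan_space p a b)) / 2)
      - ln (2 * pi * c) / 2 - ((ln (p + a) - euler_mascheroni) / 2 + (ln (p + b) - euler_mascheroni) / 2) / 2
      + (\<integral>w. bessel_err (c * (env_A w * env_B w)) \<partial>chan_space p a b))"
      by (intro has_bochner_integral_add has_bochner_integral_diff has_bochner_integral_mult_right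
          has_bochner_integral_divide const env_A_square env_B_square env_A_ln env_B_ln integral_env_mult
          has_bochner_integral_integrable int_err pos)
  qed
  also have "p\<^sup>2 / D * ((p + a) / (p + a) + (p + b) / (p + b)) = 2 * p\<^sup>2 / D"
    using pos by simp
  finally show ?thesis .
qed

section \<open>Passage to the limit\<close>

text \<open>The determinant tends to 0, so the factor \<open>c powr (-1/2)\<close> in the bound does
  too, for the constant \<open>C\<close> belonging to the tolerance \<open>e / 2\<close>.\<close>

lemma env_bessel_err_tendsto:
  assumes pos: "p > 0" "a > 0"
  shows "((\<lambda>s. \<integral>w. bessel_err (2 * p / cov_det p s (a * s) * (env_A w * env_B w)) \<partial>chan_space p s (a * s)) \<longlongrightarrow> 0) (at_right 0)"
proof (rule tendstoI)
  fix e :: real assume e: "e > 0"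
  obtain C where C: "C \<ge> 0" "\<And>t. t > 0 \<Longrightarrow> \<bar>bessel_err t\<bar> \<le> e / 2 + C * t powr (-1/2)"
    using bessel_err_bound[of "e / 2"] e by auto
  let ?c = "\<lambda>s. 2 * p / cov_det p s (a * s)"
  have "(cov_det p 0 (a * 0) / (2 * p)) = 0"
    by (simp add: cov_det_def)
  moreover have "((\<lambda>s. cov_det p s (a * s) / (2 * p)) \<longlongrightarrow> cov_det p 0 (a * 0) / (2 * p)) (at_right 0)"
    unfolding cov_det_def using pos by (intro tendsto_intros) auto
  ultimately have "((\<lambda>s. sqrt (cov_det p s (a * s) / (2 * p))) \<longlongrightarrow> 0) (at_right 0)"
    using tendsto_real_sqrt by fastforce
  then have "((\<lambda>s. e / 2 + C * (sqrt (cov_det p s (a * s) / (2 * p)) * (2 * p powr (-1/2) * Gamma (1/2))))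
      \<longlongrightarrow> e / 2 + C * (0 * (2 * p powr (-1/2) * Gamma (1/2)))) (at_right 0)"
    by (intro tendsto_intros)
  then have "eventually (\<lambda>s. e / 2 + C * (sqrt (cov_det p s (a * s) / (2 * p)) * (2 * p powr (-1/2) * Gamma (1/2))) < e) (at_right 0)"
    by (rule order_tendstoD(2)) (use e in simp)
  moreover have "eventually (\<lambda>s::real. s > 0) (at_right 0)"
    by (rule eventually_at_right_less)
  ultimately show "eventually (\<lambda>s. dist (\<integral>w. bessel_err (?c s * (env_A w * env_B w)) \<partial>chan_space p s (a * s)) 0 < e) (at_right 0)"
  proof eventually_elim
    case (elim s)
    have D: "cov_det p s (a * s) > 0"
      using pos elim by (intro cov_det_pos) auto
    then have c: "?c s > 0" using pos by simp
    have "?c s powr (-1/2) = sqrt (cov_det p s (a * s) / (2 * p))"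
      using c D pos by (simp add: powr_minus_divide powr_half_sqrt real_sqrt_divide)
    then show ?case
      using env_bessel_err_bound(2)[OF _ _ _ c C, of p s "a * s"] pos elim by simp
  qed
qed

theorem theorem1:
  fixes p a :: real
  assumes "p > 0" and "a > 0"
  shows "((\<lambda>sA2. env_MI p sA2 (a * sA2)
            - ((1/2) * log 2 (p / (sA2 + a * sA2)) - chi_const)) \<longlongrightarrow> 0) (at_right 0)"
proof -
  note pos = assms
  let ?diff = "\<lambda>s. (\<integral>w. (env_A w - env_B w)\<^sup>2 \<partial>chan_space p s (a * s)) / s"
  let ?err = "\<lambda>s. \<integral>w. bessel_err (2 * p / cov_det p s (a * s) * (env_A w * env_B w)) \<partial>chan_space p s (a * s)"
  \<comment> \<open>\<open>d s\<close> is the covariance determinant divided by \<open>s\<close>;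
    its limit is positive.\<close>
  define d where "d = (\<lambda>s. a * s + p * (1 + a))"
  \<comment> \<open>\<open>L\<close> is \<open>ln 2\<close> times the gap in the claim, written
    without divergent terms: the logarithms of \<open>s\<close> cancel and the terms of order
    \<open>1 / s\<close> are combined.\<close>
  define L where "L = (\<lambda>s. 3/4 * (ln (p + s) + ln (p + a * s)) - ln (d s) / 2 - ln p + ln (1 + a) / 2
     - 1/2 + p / d s * ((1 + a) - ?diff s) + ?err s)"
  have d0: "(d \<longlongrightarrow> p * (1 + a)) (at_right 0)"
  proof -
    have "(d \<longlongrightarrow> a * 0 + p * (1 + a)) (at_right 0)"
      unfolding d_def by (intro tendsto_intros)
    then show ?thesis by simp
  qed
  have "((\<lambda>s. p + s) \<longlongrightarrow> p + 0) (at_right 0)" "((\<lambda>s. p + a * s) \<longlongrightarrow> p + a * 0) (at_right 0)"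
    by (intro tendsto_intros)+
  then have p0: "((\<lambda>s. p + s) \<longlongrightarrow> p) (at_right 0)" "((\<lambda>s. p + a * s) \<longlongrightarrow> p) (at_right 0)"
    by simp_all
  have "(L \<longlongrightarrow> 3/4 * (ln p + ln p) - ln (p * (1 + a)) / 2 - ln p + ln (1 + a) / 2
     - 1/2 + p / (p * (1 + a)) * ((1 + a) - (1 + a) / 2) + 0) (at_right 0)"
    unfolding L_def using pos
    by (intro tendsto_intros p0 d0 env_diff_square_tendsto env_bessel_err_tendsto) auto
  also have "3/4 * (ln p + ln p) - ln (p * (1 + a)) / 2 - ln p + ln (1 + a) / 2
     - 1/2 + p / (p * (1 + a)) * ((1 + a) - (1 + a) / 2) + 0 = 0"
  proof -
    \<comment> \<open>The radial noise contributes 1/2 in the limit, which cancels the -1/2 stemming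
      from the 1 in the exponent of \<open>chi_const\<close>.\<close>
    have "(1 + a) - (1 + a) / 2 = (1 + a) / 2" by (simp add: field_simps)
    then have "p / (p * (1 + a)) * ((1 + a) - (1 + a) / 2) = 1 / 2"
      using pos by simp
    moreover have "ln (p * (1 + a)) = ln p + ln (1 + a)"
      using pos by (simp add: ln_mult_pos)
    ultimately show ?thesis by (simp add: field_simps)
  qed
  finally have "((\<lambda>s. L s / ln 2) \<longlongrightarrow> 0) (at_right 0)"
    by (auto intro: tendsto_eq_intros)
  moreover have "eventually (\<lambda>s. L s / ln 2 = env_MI p s (a * s) - ((1/2) * log 2 (p / (s + a * s)) - chi_const)) (at_right 0)"
    using eventually_at_right_less[of 0]
  proof eventually_elim
    case (elim s)
    have as: "a * s > 0" and pas: "p + a * s > 0" using pos elim by (simp_all add: add_pos_pos)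
    have dpos: "d s > 0" unfolding d_def using pos elim by (simp add: add_pos_pos)
    have D: "cov_det p s (a * s) = s * d s"
      by (simp add: cov_det_def d_def algebra_simps)
    define Dl where "Dl = (\<integral>w. (env_A w - env_B w)\<^sup>2 \<partial>chan_space p s (a * s))"
    \<comment> \<open>The contributions \<open>2 * p\<^sup>2 / (s * d s)\<close> of the quadratic
      form and of the mean product cancel, leaving a bounded expression.\<close>
    have quad: "- (2 * p\<^sup>2 / (s * d s)) + 2 * p / (s * d s) * ((2 * p + s + a * s - Dl) / 2)
        = p / d s * ((1 + a) - Dl / s)"
      using elim dpos by (simp add: field_simps power2_eq_square)
    have "p / (s + a * s) = p / (s * (1 + a))"
      by (simp add: algebra_simps)
    then have l1: "ln (p / (s + a * s)) = ln p - ln s - ln (1 + a)"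
      using pos elim by (simp add: ln_div ln_mult_pos)
    have l2: "ln ((p + s) * (p + a * s) / (s * d s)) = ln (p + s) + ln (p + a * s) - ln s - ln (d s)"
      using pos elim pas dpos by (simp add: ln_div ln_mult_pos)
    have "2 * pi * (2 * p / (s * d s)) = 4 * pi * p / (s * d s)"
      by simp
    then have l3: "ln (2 * pi * (2 * p / (s * d s))) = ln (4 * pi) + ln p - ln s - ln (d s)"
      using pos elim dpos by (simp add: ln_div ln_mult_pos)
    have l4: "ln (4 * pi / exp (1 + euler_mascheroni)) = ln (4 * pi) - (1 + euler_mascheroni)"
      by (simp add: ln_div)
    have "ln 2 * (env_MI p s (a * s) - ((1/2) * log 2 (p / (s + a * s)) - chi_const))
        = ln 2 * env_MI p s (a * s) - ln (p / (s + a * s)) / 2 + ln (4 * pi / exp (1 + euler_mascheroni)) / 2"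
      by (simp add: log_def chi_const_def field_simps)
    also have "\<dots> = L s"
    proof -
      \<comment> \<open>The bookkeeping is linear once each logarithm is a variable;
        \<open>g\<close>, the Euler-Mascheroni constant, cancels between the mean logarithms and
        \<open>chi_const\<close>.\<close>
      have "x + y - ls - ld - P + Q - (l4 + lp - ls - ld) / 2 - ((x - g) / 2 + (y - g) / 2) / 2 + e
            - (lp - ls - la) / 2 + (l4 - (1 + g)) / 2
          = 3/4 * (x + y) - ld / 2 - lp + la / 2 - 1/2 + (- P + Q) + e"
        for x y ls ld P Q l4 lp g e la :: real
        by (simp add: field_simps)
      then show ?thesis
        unfolding env_MI_expansion[OF pos(1) elim as] D l1 l2 l3 l4 L_def Dl_def[symmetric] quad[symmetric] .
    qed
    finally show ?case
      by (simp add: field_simps)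
  qed
  ultimately show ?thesis
    by (rule Lim_transform_eventually)
qed

end
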